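(* Let $G$ be an $n$-dimensional unimodular Lie group with a left-invariant pseudo-Riemannian metric $\langle\cdot,\cdot\rangle$, and let $\mathfrak{g}$ be the (unimodular) Lie algebra of left-invariant vector fields on $G$. If $X\in\mathfrak{g}$ is a conformal vector field, then $X$ is a Killing vector field.
   Context: A Lie group $G$ with Lie algebra $\mathfrak{g}$ of left-invariant vector fields is called unimodular if $\mathrm{tr}(\mathrm{ad}_X)=0$ for every $X\in\mathfrak{g}$, where $\mathrm{ad}_X(Y)=[X,Y]$. A metric on $G$ is left-invariant if all left translations are isometries. A vector field $X$ is conformal if $\mathfrak{L}_X\langle\cdot,\cdot\rangle=2\rho\langle\cdot,\cdot\rangle$ for some smooth function $\rho$ on $G$, where $\mathfrak{L}_X$ is the Lie derivative, $(\mathfrak{L}_X\langle\cdot,\cdot\rangle)(Y,Z)=X\langle Y,Z\rangle-\langle[X,Y],Z\rangle-\langle Y,[X,Z]\rangle$. A vector field $X$ is Killing if $\mathfrak{L}_X\langle\cdot,\cdot\rangle=0$. *)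

theory Defs
  imports "HOL-Analysis.Analysis" "HOL-Library.Function_Algebras" "HOL-Algebra.Group"
begin

section \<open>Functions as a real vector space\<close>

text \<open>
  Tangent vectors and vector fields are represented by functions. Together with the pointwise
  additive structure of \<^theory>\<open>HOL-Library.Function_Algebras\<close> this instance makes the linear algebra
  of \<^class>\<open>real_vector\<close> (subspaces, bases, coordinates) available for them.
\<close>

instantiation "fun" :: (type, real_vector) real_vector
begin

definition scaleR_fun :: "real \<Rightarrow> ('a \<Rightarrow> 'b) \<Rightarrow> 'a \<Rightarrow> 'b"
  where "scaleR_fun c f = (\<lambda>x. c *\<^sub>R f x)"

instance
  by standard (simp_all add: scaleR_fun_def fun_eq_iff scaleR_add_right scaleR_add_left)

end

text \<open>
  The trace of a linear endomorphism \<open>F\<close> of a finite-dimensional subspace \<open>V\<close>: the sum of the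
  diagonal entries of its matrix in a basis of \<open>V\<close>. The value does not depend on the basis.
\<close>

definition trace_on :: "'v::real_vector set \<Rightarrow> ('v \<Rightarrow> 'v) \<Rightarrow> real"
  where "trace_on V F =
    (let B = (SOME B. B \<subseteq> V \<and> independent B \<and> V \<subseteq> span B)
     in \<Sum>b\<in>B. representation B (F b) b)"


section \<open>Smooth maps between Euclidean spaces\<close>

text \<open>These notions are meant for open sets \<open>S\<close>.\<close>

primrec Ck_on :: "nat \<Rightarrow> 'a::real_normed_vector set \<Rightarrow> ('a \<Rightarrow> 'b::real_normed_vector) \<Rightarrow> bool" where
  "Ck_on 0 S f \<longleftrightarrow> continuous_on S f"
| "Ck_on (Suc k) S f \<longleftrightarrow>
     (\<forall>x\<in>S. f differentiable (at x)) \<and> (\<forall>v. Ck_on k S (\<lambda>x. frechet_derivative f (at x) v))"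

definition smooth_on :: "'a::real_normed_vector set \<Rightarrow> ('a \<Rightarrow> 'b::real_normed_vector) \<Rightarrow> bool"
  where "smooth_on S f \<longleftrightarrow> (\<forall>k. Ck_on k S f)"


section \<open>Smooth manifolds\<close>

text \<open>
  A chart is a pair \<open>(U, \<phi>)\<close> of an open set and a homeomorphism \<open>\<phi>\<close> from \<open>U\<close> onto an open subset of
  the Euclidean space \<open>'e\<close>; its inverse is \<open>inv_into U \<phi>\<close>. The dimension of the manifold is
  \<open>DIM('e)\<close>. The atlas need not be maximal. Only the values of \<open>\<phi>\<close> on \<open>U\<close> are relevant.
\<close>

type_synonym ('a, 'e) atlas = "('a set \<times> ('a \<Rightarrow> 'e)) set"

locale smooth_manifold =
  fixes T :: "'a topology" and A :: "('a, 'e::euclidean_space) atlas"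
  assumes Hausdorff: "Hausdorff_space T"
    and second_countable: "second_countable T"
    and chart_open: "(U, \<phi>) \<in> A \<Longrightarrow> openin T U"
    and chart_image_open: "(U, \<phi>) \<in> A \<Longrightarrow> open (\<phi> ` U)"
    and chart_homeomorphism:
      "(U, \<phi>) \<in> A \<Longrightarrow> homeomorphic_map (subtopology T U) (top_of_set (\<phi> ` U)) \<phi>"
    and charts_cover: "(\<Union>(U, \<phi>)\<in>A. U) = topspace T"
    and charts_compatible:
      "(U, \<phi>) \<in> A \<Longrightarrow> (V, \<psi>) \<in> A \<Longrightarrow> smooth_on (\<phi> ` (U \<inter> V)) (\<psi> \<circ> inv_into U \<phi>)"

definition prod_atlas :: "('a, 'e) atlas \<Rightarrow> ('b, 'f) atlas \<Rightarrow> ('a \<times> 'b, 'e \<times> 'f) atlas"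
  where "prod_atlas A B = {(U \<times> V, map_prod \<phi> \<psi>) | U \<phi> V \<psi>. (U, \<phi>) \<in> A \<and> (V, \<psi>) \<in> B}"

definition smooth_map ::
    "'a topology \<Rightarrow> ('a, 'e::euclidean_space) atlas \<Rightarrow>
     'b topology \<Rightarrow> ('b, 'f::euclidean_space) atlas \<Rightarrow> ('a \<Rightarrow> 'b) \<Rightarrow> bool"
  where "smooth_map T A T' A' F \<longleftrightarrow>
    continuous_map T T' F \<and>
    (\<forall>(U, \<phi>)\<in>A. \<forall>(V, \<psi>)\<in>A'. smooth_on (\<phi> ` {x\<in>U. F x \<in> V}) (\<psi> \<circ> F \<circ> inv_into U \<phi>))"

definition smooth_fun_on :: "('a, 'e::euclidean_space) atlas \<Rightarrow> 'a set \<Rightarrow> ('a \<Rightarrow> real) \<Rightarrow> bool"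
  where "smooth_fun_on A W f \<longleftrightarrow> (\<forall>(U, \<phi>)\<in>A. smooth_on (\<phi> ` (U \<inter> W)) (f \<circ> inv_into U \<phi>))"

definition smooth_near ::
    "'a topology \<Rightarrow> ('a, 'e::euclidean_space) atlas \<Rightarrow> 'a \<Rightarrow> ('a \<Rightarrow> real) \<Rightarrow> bool"
  where "smooth_near T A p f \<longleftrightarrow> (\<exists>W. openin T W \<and> p \<in> W \<and> smooth_fun_on A W f)"


section \<open>Tangent vectors and vector fields\<close>

type_synonym 'a tangent_vector = "('a \<Rightarrow> real) \<Rightarrow> real"
type_synonym 'a vector_field = "'a \<Rightarrow> 'a tangent_vector"

text \<open>
  Tangent vectors at \<open>p\<close> are the derivations at \<open>p\<close> of the algebra of real functions that are smooth
  in some neighbourhood of \<open>p\<close>. Such a derivation depends only on the germ: if \<open>h\<close> vanishes near \<open>p\<close>,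
  then \<open>h = u * h\<close> where \<open>u\<close> is \<open>0\<close> near \<open>p\<close> and \<open>1\<close> elsewhere, so \<open>v h = 0\<close> by the Leibniz rule.
  The value \<open>0\<close> on all other functions makes equality of tangent vectors extensional.
\<close>

definition tangent_space ::
    "'a topology \<Rightarrow> ('a, 'e::euclidean_space) atlas \<Rightarrow> 'a \<Rightarrow> 'a tangent_vector set"
  where "tangent_space T A p = {v.
    (\<forall>f h. smooth_near T A p f \<longrightarrow> smooth_near T A p h \<longrightarrow>
       v (\<lambda>x. f x + h x) = v f + v h \<and>
       v (\<lambda>x. f x * h x) = f p * v h + h p * v f) \<and>
    (\<forall>c f. smooth_near T A p f \<longrightarrow> v (\<lambda>x. c * f x) = c * v f) \<and>
    (\<forall>f. \<not> smooth_near T A p f \<longrightarrow> v f = 0)}"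

text \<open>The differential of \<open>F\<close> at \<open>p\<close>, with respect to the same manifold as source and target.\<close>

definition pushforward ::
    "'a topology \<Rightarrow> ('a, 'e::euclidean_space) atlas \<Rightarrow> ('a \<Rightarrow> 'a) \<Rightarrow> 'a \<Rightarrow>
     'a tangent_vector \<Rightarrow> 'a tangent_vector"
  where "pushforward T A F p v = (\<lambda>f. if smooth_near T A (F p) f then v (f \<circ> F) else 0)"

text \<open>Smooth vector fields on the whole manifold, extended by \<open>0\<close> off \<open>topspace T\<close>.\<close>

definition vector_fields ::
    "'a topology \<Rightarrow> ('a, 'e::euclidean_space) atlas \<Rightarrow> 'a vector_field set"
  where "vector_fields T A = {X.
    (\<forall>p\<in>topspace T. X p \<in> tangent_space T A p) \<and>
    (\<forall>p. p \<notin> topspace T \<longrightarrow> X p = 0) \<and>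
    (\<forall>W f. openin T W \<longrightarrow> smooth_fun_on A W f \<longrightarrow> smooth_fun_on A W (\<lambda>p. X p f))}"

definition lie_bracket ::
    "'a topology \<Rightarrow> ('a, 'e::euclidean_space) atlas \<Rightarrow>
     'a vector_field \<Rightarrow> 'a vector_field \<Rightarrow> 'a vector_field"
  where "lie_bracket T A X Y = (\<lambda>p f.
    if smooth_near T A p f then X p (\<lambda>q. Y q f) - Y p (\<lambda>q. X q f) else 0)"


section \<open>Lie groups\<close>

locale lie_group = smooth_manifold T A + group G
  for G :: "('a, 'm) monoid_scheme" (structure)
    and T :: "'a topology" and A :: "('a, 'e::euclidean_space) atlas" +
  assumes carrier_eq_topspace: "carrier G = topspace T"
    and smooth_mult:
      "smooth_map (prod_topology T T) (prod_atlas A A) T A (\<lambda>(x, y). x \<otimes> y)"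
    and smooth_inv: "smooth_map T A T A (\<lambda>x. inv x)"

definition lie_algebra ::
    "('a, 'm) monoid_scheme \<Rightarrow> 'a topology \<Rightarrow> ('a, 'e::euclidean_space) atlas \<Rightarrow>
     'a vector_field set"
  where "lie_algebra G T A = {X \<in> vector_fields T A.
    \<forall>a\<in>carrier G. \<forall>b\<in>carrier G. pushforward T A (\<lambda>x. a \<otimes>\<^bsub>G\<^esub> x) b (X b) = X (a \<otimes>\<^bsub>G\<^esub> b)}"

definition unimodular ::
    "('a, 'm) monoid_scheme \<Rightarrow> 'a topology \<Rightarrow> ('a, 'e::euclidean_space) atlas \<Rightarrow> bool"
  where "unimodular G T A \<longleftrightarrow>
    (\<forall>X\<in>lie_algebra G T A. trace_on (lie_algebra G T A) (lie_bracket T A X) = 0)"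


section \<open>Pseudo-Riemannian metrics\<close>

type_synonym 'a metric_tensor = "'a \<Rightarrow> 'a tangent_vector \<Rightarrow> 'a tangent_vector \<Rightarrow> real"

text \<open>
  Only the values \<open>g p u v\<close> with \<open>u\<close> and \<open>v\<close> tangent at \<open>p\<close> are relevant. Constancy of the index is
  not required separately: it is automatic for left-invariant metrics.
\<close>

definition pseudo_riemannian_metric ::
    "'a topology \<Rightarrow> ('a, 'e::euclidean_space) atlas \<Rightarrow> 'a metric_tensor \<Rightarrow> bool"
  where "pseudo_riemannian_metric T A g \<longleftrightarrow>
    (\<forall>p\<in>topspace T.
       (\<forall>u\<in>tangent_space T A p. \<forall>v\<in>tangent_space T A p. g p u v = g p v u) \<and>
       (\<forall>u\<in>tangent_space T A p. \<forall>v\<in>tangent_space T A p. \<forall>w\<in>tangent_space T A p. \<forall>c d.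
          g p (c *\<^sub>R u + d *\<^sub>R v) w = c * g p u w + d * g p v w) \<and>
       (\<forall>u\<in>tangent_space T A p. (\<forall>v\<in>tangent_space T A p. g p u v = 0) \<longrightarrow> u = 0)) \<and>
    (\<forall>X\<in>vector_fields T A. \<forall>Y\<in>vector_fields T A.
       smooth_fun_on A (topspace T) (\<lambda>p. g p (X p) (Y p)))"

text \<open>Every left translation is an isometry.\<close>

definition left_invariant_metric ::
    "('a, 'm) monoid_scheme \<Rightarrow> 'a topology \<Rightarrow> ('a, 'e::euclidean_space) atlas \<Rightarrow>
     'a metric_tensor \<Rightarrow> bool"
  where "left_invariant_metric G T A g \<longleftrightarrow>
    (\<forall>a\<in>carrier G. \<forall>b\<in>carrier G. \<forall>u\<in>tangent_space T A b. \<forall>v\<in>tangent_space T A b.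
       g (a \<otimes>\<^bsub>G\<^esub> b) (pushforward T A (\<lambda>x. a \<otimes>\<^bsub>G\<^esub> x) b u)
                   (pushforward T A (\<lambda>x. a \<otimes>\<^bsub>G\<^esub> x) b v) = g b u v)"

definition lie_derivative_metric ::
    "'a topology \<Rightarrow> ('a, 'e::euclidean_space) atlas \<Rightarrow> 'a metric_tensor \<Rightarrow>
     'a vector_field \<Rightarrow> 'a vector_field \<Rightarrow> 'a vector_field \<Rightarrow> 'a \<Rightarrow> real"
  where "lie_derivative_metric T A g X Y Z = (\<lambda>p.
    X p (\<lambda>q. g q (Y q) (Z q))
      - g p (lie_bracket T A X Y p) (Z p) - g p (Y p) (lie_bracket T A X Z p))"

definition conformal_vector_field ::
    "'a topology \<Rightarrow> ('a, 'e::euclidean_space) atlas \<Rightarrow> 'a metric_tensor \<Rightarrow> 'a vector_field \<Rightarrow> bool"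
  where "conformal_vector_field T A g X \<longleftrightarrow> X \<in> vector_fields T A \<and>
    (\<exists>\<rho>. smooth_fun_on A (topspace T) \<rho> \<and>
      (\<forall>Y\<in>vector_fields T A. \<forall>Z\<in>vector_fields T A. \<forall>p\<in>topspace T.
         lie_derivative_metric T A g X Y Z p = 2 * \<rho> p * g p (Y p) (Z p)))"

definition killing_vector_field ::
    "'a topology \<Rightarrow> ('a, 'e::euclidean_space) atlas \<Rightarrow> 'a metric_tensor \<Rightarrow> 'a vector_field \<Rightarrow> bool"
  where "killing_vector_field T A g X \<longleftrightarrow> X \<in> vector_fields T A \<and>
    (\<forall>Y\<in>vector_fields T A. \<forall>Z\<in>vector_fields T A. \<forall>p\<in>topspace T.
       lie_derivative_metric T A g X Y Z p = 0)"

end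

theory Submission
  imports Defs
begin

text \<open>
  On left-invariant fields the metric is constant, so a conformal \<open>X \<in> \<g>\<close> satisfies
  \<open>\<langle>[X, Y], Z\<rangle> + \<langle>Y, [X, Z]\<rangle> = - 2 \<rho>(p) \<langle>Y, Z\<rangle>\<close> on \<open>\<g>\<close>, for each point \<open>p\<close>. If the form is nondegenerate
  on \<open>\<g>\<close>, taking traces yields \<open>2 tr(ad X) = - 2 \<rho>(p) dim \<g>\<close>, hence \<open>\<rho>(p) = 0\<close> by unimodularity.
  Finite dimension and nondegeneracy follow from \<open>\<g> \<cong> T\<^sub>\<one>G\<close>: evaluation at \<open>\<one>\<close> is injective, and it is
  surjective because the left-invariant extension of a derivation at \<open>\<one>\<close> is smooth. For the latter the
  derivation must be a combination of partial derivatives, which is Hadamard's lemma.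
\<close>

section \<open>Calculus of smooth maps\<close>

text \<open>Derivations act here on functions that are defined everywhere but smooth only near the
  base point. Many identities between such functions hold just on an open set, or just on the
  carrier of the group, and \<open>tangent_local\<close> is what carries them through a derivation.
  A derivation is given algebraically, so how v(f o L_a) depends on a cannot be read off its
  definition. Hadamard's lemma reduces v to finitely many numbers, which gives both this smoothness
  and the bound on the dimension. The Killing equation concerns arbitrary smooth fields, the trace
  argument only left-invariant ones. The bridge is that the trace forces \<rho> to vanish at each p
  separately, after which the conformal equation at p covers all fields. The metric may be
  indefinite, so the trace is computed in a pair of dual bases, whose existence rests on
  nondegeneracy alone. The dimension is only bounded from above, so an empty basis remains as a
  separate case: there the trace says nothing about \<rho>, but every tangent vector is 0.\<close>

lemma Ck_on_subset: "Ck_on k S f \<Longrightarrow> T \<subseteq> S \<Longrightarrow> Ck_on k T f"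
  by (induction k arbitrary: f) (auto intro: continuous_on_subset)

text \<open>Openness is essential: \<open>Ck_on\<close> uses derivatives in the full space, and
  these depend on the values in a neighbourhood of each point.\<close>

lemma Ck_on_cong:
  assumes "open S" "\<And>x. x \<in> S \<Longrightarrow> f x = g x" "Ck_on k S f"
  shows "Ck_on k S g"
  using assms(2,3)
proof (induction k arbitrary: f g)
  case 0
  then show ?case by (simp cong: continuous_on_cong_simp)
next
  case (Suc k)
  have d: "(g has_derivative frechet_derivative f (at x)) (at x)" if "x \<in> S" for x
    using has_derivative_transform_within_open[of f "frechet_derivative f (at x)" x UNIV S g]
      Suc.prems assms(1) that frechet_derivative_works[of f "at x"] by auto
  have "frechet_derivative f (at x) v = frechet_derivative g (at x) v" if "x \<in> S" for x v
    using frechet_derivative_at[OF d[OF that]] by simp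
  then have "Ck_on k S (\<lambda>x. frechet_derivative g (at x) v)" for v
    using Suc.IH[of "\<lambda>x. frechet_derivative f (at x) v" "\<lambda>x. frechet_derivative g (at x) v"] Suc.prems
    by auto
  with d show ?case
    by (auto simp: differentiable_def)
qed

text \<open>Lets an explicit derivative formula stand in for \<open>frechet_derivative\<close>. Each
  closure property below is then an induction on the order applied to that formula.\<close>

lemma Ck_on_SucI:
  assumes "open S" "\<And>x. x \<in> S \<Longrightarrow> (f has_derivative f' x) (at x)"
    "\<And>v. Ck_on k S (\<lambda>x. f' x v)"
  shows "Ck_on (Suc k) S f"
proof -
  have "frechet_derivative f (at x) = f' x" if "x \<in> S" for x
    using frechet_derivative_at[OF assms(2)[OF that]] by simp
  then have "Ck_on k S (\<lambda>x. frechet_derivative f (at x) v)" for v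
    using Ck_on_cong[OF assms(1) _ assms(3)[of v]] by simp
  with assms(2) show ?thesis
    by (auto simp: differentiable_def)
qed

lemma Ck_on_Suc_derivative:
  "Ck_on (Suc k) S f \<Longrightarrow> x \<in> S \<Longrightarrow> (f has_derivative frechet_derivative f (at x)) (at x)"
  by (simp add: frechet_derivative_works[symmetric])

lemma Ck_on_SucD: "Ck_on (Suc k) S f \<Longrightarrow> Ck_on k S f"
proof (induction k arbitrary: f)
  case 0
  then show ?case
    by (simp add: continuous_at_imp_continuous_on differentiable_imp_continuous_within)
next
  case (Suc k)
  have "Ck_on k S (\<lambda>x. frechet_derivative f (at x) v)" for v
    by (rule Suc.IH) (use Suc.prems in simp)
  then show ?case
    using Suc.prems by simp
qed

lemma Ck_on_continuous: "Ck_on k S f \<Longrightarrow> continuous_on S f"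
  by (induction k) (use Ck_on_SucD in \<open>auto simp del: Ck_on.simps(2)\<close>)

lemma Ck_on_const: "Ck_on k S (\<lambda>x. c)"
  by (induction k arbitrary: c) auto

lemma Ck_on_bounded_linear_comp:
  assumes "open S" "bounded_linear L"
  shows "Ck_on k S f \<Longrightarrow> Ck_on k S (\<lambda>x. L (f x))"
proof (induction k arbitrary: f)
  case 0
  then show ?case
    using assms(2) by (simp add: bounded_linear.continuous_on)
next
  case (Suc k)
  show ?case
  proof (rule Ck_on_SucI[OF assms(1)])
    show "((\<lambda>x. L (f x)) has_derivative (\<lambda>v. L (frechet_derivative f (at x) v))) (at x)"
      if "x \<in> S" for x
      by (rule bounded_linear.has_derivative[OF assms(2)])
        (use Ck_on_Suc_derivative Suc.prems that in blast)
    show "Ck_on k S (\<lambda>x. L (frechet_derivative f (at x) v))" for v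
      by (rule Suc.IH) (use Suc.prems in simp)
  qed
qed

lemma Ck_on_bounded_linear:
  assumes "open S" "bounded_linear L"
  shows "Ck_on k S L"
proof (cases k)
  case 0
  then show ?thesis
    using assms(2) by (simp add: linear_continuous_on)
next
  case (Suc k)
  show ?thesis
    unfolding Suc by (rule Ck_on_SucI[OF assms(1) bounded_linear_imp_has_derivative[OF assms(2)] Ck_on_const])
qed

lemma Ck_on_add:
  assumes "open S"
  shows "Ck_on k S f \<Longrightarrow> Ck_on k S g \<Longrightarrow> Ck_on k S (\<lambda>x. f x + g x)"
proof (induction k arbitrary: f g)
  case 0
  then show ?case by (simp add: continuous_on_add)
next
  case (Suc k)
  show ?case
  proof (rule Ck_on_SucI[OF assms(1)])
    show "((\<lambda>x. f x + g x) has_derivative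
        (\<lambda>v. frechet_derivative f (at x) v + frechet_derivative g (at x) v)) (at x)"
      if "x \<in> S" for x
      by (rule has_derivative_add) (use Ck_on_Suc_derivative Suc.prems that in blast)+
    show "Ck_on k S (\<lambda>x. frechet_derivative f (at x) v + frechet_derivative g (at x) v)" for v
      by (rule Suc.IH) (use Suc.prems in simp_all)
  qed
qed

lemma Ck_on_sum:
  assumes "open S" "\<And>i. i \<in> I \<Longrightarrow> Ck_on k S (f i)"
  shows "Ck_on k S (\<lambda>x. \<Sum>i\<in>I. f i x)"
  using assms(2)
  by (induction I rule: infinite_finite_induct) (simp_all add: Ck_on_const Ck_on_add[OF assms(1)])

lemma Ck_on_scaleR:
  fixes g :: "'a::real_normed_vector \<Rightarrow> real" and f :: "'a \<Rightarrow> 'b::real_normed_vector"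
  assumes "open S"
  shows "Ck_on k S g \<Longrightarrow> Ck_on k S f \<Longrightarrow> Ck_on k S (\<lambda>x. g x *\<^sub>R f x)"
proof (induction k arbitrary: f g)
  case 0
  then show ?case by (simp add: continuous_on_scaleR)
next
  case (Suc k)
  show ?case
  proof (rule Ck_on_SucI[OF assms(1)])
    show "((\<lambda>x. g x *\<^sub>R f x) has_derivative
        (\<lambda>v. g x *\<^sub>R frechet_derivative f (at x) v + frechet_derivative g (at x) v *\<^sub>R f x)) (at x)"
      if "x \<in> S" for x
      by (rule has_derivative_scaleR) (use Ck_on_Suc_derivative Suc.prems that in blast)+
    show "Ck_on k S (\<lambda>x. g x *\<^sub>R frechet_derivative f (at x) v
        + frechet_derivative g (at x) v *\<^sub>R f x)" for v
      by (rule Ck_on_add[OF assms(1)]; rule Suc.IH) (use Suc.prems Ck_on_SucD in auto)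
  qed
qed

lemma frechet_derivative_Basis_sum:
  fixes f :: "'a::euclidean_space \<Rightarrow> 'b::real_normed_vector"
  assumes "f differentiable at x"
  shows "frechet_derivative f (at x) v = (\<Sum>b\<in>Basis. (v \<bullet> b) *\<^sub>R frechet_derivative f (at x) b)"
  using linear_sum[OF linear_frechet_derivative[OF assms], of "\<lambda>b. (v \<bullet> b) *\<^sub>R b" Basis]
  by (simp add: euclidean_representation linear_cmul[OF linear_frechet_derivative[OF assms]])

text \<open>In the chain rule the direction fed to the derivative of g varies with x, while the
  induction hypothesis handles fixed directions only. Expanding the direction in
  \<open>Basis\<close> leaves a finite sum of products of functions of class C^k, which is why the
  middle space is Euclidean.\<close>

lemma Ck_on_compose:
  fixes f :: "'a::real_normed_vector \<Rightarrow> 'b::euclidean_space"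
    and g :: "'b \<Rightarrow> 'c::real_normed_vector"
  assumes "open S" "f ` S \<subseteq> S'"
  shows "Ck_on k S f \<Longrightarrow> Ck_on k S' g \<Longrightarrow> Ck_on k S (\<lambda>x. g (f x))"
proof (induction k arbitrary: g)
  case 0
  then show ?case using assms continuous_on_compose2[of S' g S f] by simp
next
  case (Suc k)
  let ?df = "\<lambda>x. frechet_derivative f (at x)" and ?dg = "\<lambda>y. frechet_derivative g (at y)"
  show ?case
  proof (rule Ck_on_SucI[OF assms(1)])
    fix x assume x: "x \<in> S"
    have "f x \<in> S'" using x assms by auto
    then have diff: "(g has_derivative ?dg (f x)) (at (f x))" "g differentiable at (f x)"
      using Suc.prems(2) Ck_on_Suc_derivative by (blast, simp)
    have "?dg (f x) (?df x v) = (\<Sum>b\<in>Basis. (?df x v \<bullet> b) *\<^sub>R ?dg (f x) b)" for v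
      by (rule frechet_derivative_Basis_sum[OF diff(2)])
    moreover have "((\<lambda>x. g (f x)) has_derivative (\<lambda>v. ?dg (f x) (?df x v))) (at x)"
      using diff_chain_at[OF Ck_on_Suc_derivative[OF Suc.prems(1) x] diff(1)]
      by (simp add: o_def)
    ultimately show "((\<lambda>x. g (f x)) has_derivative
        (\<lambda>v. \<Sum>b\<in>Basis. (?df x v \<bullet> b) *\<^sub>R ?dg (f x) b)) (at x)"
      by simp
  next
    fix v
    have "Ck_on k S (\<lambda>x. ?df x v \<bullet> b)" for b
      by (rule Ck_on_bounded_linear_comp[OF assms(1) bounded_linear_inner_left])
        (use Suc.prems in simp)
    moreover have "Ck_on k S (\<lambda>x. ?dg (f x) b)" for b
      by (rule Suc.IH) (use Suc.prems Ck_on_SucD in auto)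
    ultimately show "Ck_on k S (\<lambda>x. \<Sum>b\<in>Basis. (?df x v \<bullet> b) *\<^sub>R ?dg (f x) b)"
      by (intro Ck_on_sum Ck_on_scaleR assms(1))
  qed
qed

lemma Ck_on_local:
  assumes "open S" "\<And>x. x \<in> S \<Longrightarrow> \<exists>N. open N \<and> x \<in> N \<and> Ck_on k N f"
  shows "Ck_on k S f"
  using assms(2)
proof (induction k arbitrary: f)
  case 0
  then have "\<And>x. x \<in> S \<Longrightarrow> continuous (at x) f"
    by (metis Ck_on.simps(1) continuous_on_eq_continuous_at)
  then show ?case by (simp add: continuous_at_imp_continuous_on)
next
  case (Suc k)
  show ?case
    using Suc.prems by (auto intro!: Suc.IH) meson+
qed

section \<open>Closure properties of smooth maps\<close>

lemma smooth_on_continuous: "smooth_on S f \<Longrightarrow> continuous_on S f"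
  unfolding smooth_on_def using Ck_on_continuous by blast

lemma smooth_on_subset: "smooth_on S f \<Longrightarrow> T \<subseteq> S \<Longrightarrow> smooth_on T f"
  unfolding smooth_on_def using Ck_on_subset by blast

lemma smooth_on_cong:
  "open S \<Longrightarrow> (\<And>x. x \<in> S \<Longrightarrow> f x = g x) \<Longrightarrow> smooth_on S f \<Longrightarrow> smooth_on S g"
  unfolding smooth_on_def using Ck_on_cong[of S f g] by blast

lemma smooth_on_const: "smooth_on S (\<lambda>x. c)"
  unfolding smooth_on_def using Ck_on_const by blast

lemma smooth_on_bounded_linear: "open S \<Longrightarrow> bounded_linear L \<Longrightarrow> smooth_on S L"
  unfolding smooth_on_def using Ck_on_bounded_linear by blast

lemma smooth_on_bounded_linear_comp:
  "open S \<Longrightarrow> bounded_linear L \<Longrightarrow> smooth_on S f \<Longrightarrow> smooth_on S (\<lambda>x. L (f x))"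
  unfolding smooth_on_def using Ck_on_bounded_linear_comp by blast

lemma smooth_on_add:
  "open S \<Longrightarrow> smooth_on S f \<Longrightarrow> smooth_on S g \<Longrightarrow> smooth_on S (\<lambda>x. f x + g x)"
  unfolding smooth_on_def using Ck_on_add by blast

lemma smooth_on_sum:
  "open S \<Longrightarrow> (\<And>i. i \<in> I \<Longrightarrow> smooth_on S (f i)) \<Longrightarrow> smooth_on S (\<lambda>x. \<Sum>i\<in>I. f i x)"
  unfolding smooth_on_def using Ck_on_sum[of S I] by blast

lemma smooth_on_mult:
  fixes f g :: "'a::real_normed_vector \<Rightarrow> real"
  shows "open S \<Longrightarrow> smooth_on S f \<Longrightarrow> smooth_on S g \<Longrightarrow> smooth_on S (\<lambda>x. f x * g x)"
  unfolding smooth_on_def using Ck_on_scaleR[of S _ f g] by simp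

lemma smooth_on_compose:
  fixes f :: "'a::real_normed_vector \<Rightarrow> 'b::euclidean_space"
    and g :: "'b \<Rightarrow> 'c::real_normed_vector"
  shows "open S \<Longrightarrow> f ` S \<subseteq> S' \<Longrightarrow> smooth_on S f \<Longrightarrow> smooth_on S' g \<Longrightarrow> smooth_on S (\<lambda>x. g (f x))"
  unfolding smooth_on_def using Ck_on_compose by blast

lemma smooth_on_local:
  assumes "open S" "\<And>x. x \<in> S \<Longrightarrow> \<exists>N. open N \<and> x \<in> N \<and> smooth_on N f"
  shows "smooth_on S f"
  unfolding smooth_on_def
proof
  fix k show "Ck_on k S f"
    using assms Ck_on_local[of S k f] unfolding smooth_on_def by meson
qed

text \<open>The pair is a sum of two linear embeddings, so closure under addition and bounded linear
  maps suffices.\<close>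

lemma smooth_on_Pair:
  assumes "open S" "smooth_on S f" "smooth_on S g"
  shows "smooth_on S (\<lambda>x. (f x, g x))"
proof -
  have "smooth_on S (\<lambda>x. (f x, 0) + (0, g x))"
    by (intro smooth_on_add assms smooth_on_bounded_linear_comp[of S "\<lambda>x. (x, 0)" f]
        smooth_on_bounded_linear_comp[of S "\<lambda>x. (0, x)" g] bounded_linear_Pair
        bounded_linear_ident bounded_linear_zero)
  then show ?thesis by simp
qed

lemma smooth_on_differentiable: "smooth_on S f \<Longrightarrow> x \<in> S \<Longrightarrow> f differentiable at x"
  unfolding smooth_on_def using Ck_on.simps(2)[of 0] by blast

lemma smooth_on_frechet_derivative:
  "smooth_on S f \<Longrightarrow> smooth_on S (\<lambda>x. frechet_derivative f (at x) v)"
  unfolding smooth_on_def using Ck_on.simps(2) by blast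

section \<open>Hadamard's lemma\<close>

lemma ray_in_ball:
  fixes x x0 :: "'a::real_normed_vector" and t :: real
  assumes "x \<in> ball x0 r" "t \<in> cbox 0 1"
  shows "x0 + t *\<^sub>R (x - x0) \<in> ball x0 r"
proof -
  have "norm (t *\<^sub>R (x - x0)) \<le> norm (x - x0)"
    using assms(2) by (auto intro: mult_left_le_one_le)
  then show ?thesis using assms(1) by (simp add: dist_norm norm_minus_commute)
qed

text \<open>Differentiating under the integral sign turns \<phi> into its partial derivatives and
  produces one more factor t. The weight \<open>t ^ m\<close> makes the claim stable under this
  step; \<open>Hadamard\<close> uses m = 0.\<close>

lemma Ck_on_integral_ray:
  fixes \<phi> :: "'a::euclidean_space \<Rightarrow> real"
  assumes "Ck_on k (ball x0 r) \<phi>"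
  shows "Ck_on k (ball x0 r) (\<lambda>x. integral {0..1} (\<lambda>t. t ^ m * \<phi> (x0 + t *\<^sub>R (x - x0))))"
  using assms
proof (induction k arbitrary: \<phi> m)
  have ray: "x0 + t *\<^sub>R (x - x0) \<in> ball x0 r" if "x \<in> ball x0 r" "t \<in> cbox 0 1" for x and t :: real
    using that by (rule ray_in_ball)
  have cont: "continuous_on (ball x0 r \<times> cbox 0 1) (\<lambda>(x, t). t ^ m * \<psi> (x0 + t *\<^sub>R (x - x0)))"
    if "continuous_on (ball x0 r) \<psi>" for m and \<psi> :: "'a \<Rightarrow> real"
    unfolding case_prod_beta
    by (intro continuous_intros continuous_on_compose2[OF that]) (use ray in auto)
  have slice: "u x integrable_on cbox 0 1"
    if "continuous_on (ball x0 r \<times> cbox 0 1) (\<lambda>(x, t). u x t)" "x \<in> ball x0 r"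
    for u :: "'a \<Rightarrow> real \<Rightarrow> 'b::banach" and x
  proof -
    have "continuous_on (cbox 0 1) (\<lambda>t. (x, t))"
      by (intro continuous_intros)
    then have "continuous_on (cbox 0 1) (\<lambda>t. case (x, t) of (x, t) \<Rightarrow> u x t)"
      by (rule continuous_on_compose2[OF that(1)]) (use that(2) in blast)
    then show ?thesis
      by (simp add: integrable_continuous_real)
  qed
  {
    case 0
    then show ?case
      using integral_continuous_on_param[OF cont[of \<phi> m]] by simp
  next
    case (Suc k)
    let ?D = "\<lambda>b x. frechet_derivative \<phi> (at x) b"
    \<comment> \<open>\<open>leibniz_rule\<close> expects the derivative of the integrand as a
      bounded linear function depending continuously on (x, t). Writing it as a combination of fixed
      functionals reduces that continuity to the scalar coefficients.\<close>
    define fx where "fx x t = (\<Sum>b\<in>Basis. (t ^ Suc m * ?D b (x0 + t *\<^sub>R (x - x0))) *\<^sub>R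
      blinfun_inner_right b)" for x and t :: real
    have contD: "continuous_on (ball x0 r) (?D b)" for b
      using Suc.prems Ck_on_continuous[of k "ball x0 r" "?D b"] by simp
    have fx: "((\<lambda>x. t ^ m * \<phi> (x0 + t *\<^sub>R (x - x0))) has_derivative blinfun_apply (fx x t)) (at x)"
      if "x \<in> ball x0 r" "t \<in> cbox 0 1" for x t
    proof -
      let ?y = "x0 + t *\<^sub>R (x - x0)"
      have d: "(\<phi> has_derivative frechet_derivative \<phi> (at ?y)) (at ?y)" "\<phi> differentiable at ?y"
        using ray[OF that] Suc.prems Ck_on_Suc_derivative by (blast, auto)
      have "((\<lambda>x. x0 + t *\<^sub>R (x - x0)) has_derivative (\<lambda>v. t *\<^sub>R v)) (at x)"
        by (auto intro!: derivative_eq_intros)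
      from diff_chain_at[OF this d(1)]
      have "((\<lambda>x. \<phi> (x0 + t *\<^sub>R (x - x0))) has_derivative (\<lambda>v. frechet_derivative \<phi> (at ?y) (t *\<^sub>R v))) (at x)"
        by (simp add: o_def)
      then have "((\<lambda>x. t ^ m * \<phi> (x0 + t *\<^sub>R (x - x0))) has_derivative
          (\<lambda>v. t ^ m * frechet_derivative \<phi> (at ?y) (t *\<^sub>R v))) (at x)"
        by (rule has_derivative_mult_right)
      moreover have "t ^ m * frechet_derivative \<phi> (at ?y) (t *\<^sub>R v) = blinfun_apply (fx x t) v" for v
        unfolding frechet_derivative_Basis_sum[OF d(2), of "t *\<^sub>R v"] fx_def
        by (simp add: blinfun.bilinear_simps sum_distrib_left inner_commute algebra_simps)
      ultimately show ?thesis by (rule has_derivative_eq_rhs[OF _ ext])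
    qed
    have cfx: "continuous_on (ball x0 r \<times> cbox 0 1) (\<lambda>(x, t). fx x t)"
      unfolding fx_def case_prod_beta
      by (intro continuous_on_sum continuous_on_scaleR continuous_on_const
          cont[OF contD, of "Suc m", unfolded case_prod_beta])
    let ?I = "\<lambda>m \<psi> x. integral (cbox 0 1) (\<lambda>t. t ^ m * \<psi> (x0 + t *\<^sub>R (x - x0)))"
    have int: "(\<lambda>t. t ^ m * \<psi> (x0 + t *\<^sub>R (x - x0))) integrable_on cbox 0 1"
      if "continuous_on (ball x0 r) \<psi>" "x \<in> ball x0 r" for m \<psi> x
      by (rule slice[OF cont[OF that(1)] that(2)])
    have der: "((?I m \<phi>) has_derivative blinfun_apply (integral (cbox 0 1) (fx x))) (at x)"
      if x: "x \<in> ball x0 r" for x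
    proof -
      have "((?I m \<phi>) has_derivative blinfun_apply (integral (cbox 0 1) (fx x))) (at x within ball x0 r)"
        by (rule leibniz_rule[OF _ _ cfx x convex_ball])
          (fact int[OF Ck_on_continuous[OF Suc.prems]] has_derivative_at_withinI[OF fx])+
      then show ?thesis
        using at_within_open[OF x open_ball] by simp
    qed
    have apply_eq: "blinfun_apply (integral (cbox 0 1) (fx x)) v = (\<Sum>b\<in>Basis. (v \<bullet> b) * ?I (Suc m) (?D b) x)"
      if x: "x \<in> ball x0 r" for x v
    proof -
      have "fx x integrable_on cbox 0 1"
        by (rule slice[OF cfx x])
      then have "blinfun_apply (integral (cbox 0 1) (fx x)) v = integral (cbox 0 1) (\<lambda>t. blinfun_apply (fx x t) v)"
        using integral_linear[OF _ blinfun.bounded_linear_left, of "fx x" _ v] by (simp add: o_def)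
      also have "\<dots> = integral (cbox 0 1) (\<lambda>t. \<Sum>b\<in>Basis. (v \<bullet> b) * (t ^ Suc m * ?D b (x0 + t *\<^sub>R (x - x0))))"
        unfolding fx_def by (simp add: blinfun.bilinear_simps inner_commute mult.commute)
      also have "\<dots> = (\<Sum>b\<in>Basis. (v \<bullet> b) * ?I (Suc m) (?D b) x)"
        unfolding integral_mult_right[symmetric]
        by (intro integral_sum finite_Basis integrable_on_mult_right int contD x)
      finally show ?thesis .
    qed
    have "((?I m \<phi>) has_derivative (\<lambda>v. \<Sum>b\<in>Basis. (v \<bullet> b) * ?I (Suc m) (?D b) x)) (at x)"
      if "x \<in> ball x0 r" for x
      by (rule has_derivative_eq_rhs[OF der ext[OF apply_eq]]) (fact that)+
    moreover have "Ck_on k (ball x0 r) (\<lambda>x. \<Sum>b\<in>Basis. (v \<bullet> b) * ?I (Suc m) (?D b) x)" for v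
    proof (intro Ck_on_sum open_ball)
      fix b
      have "Ck_on k (ball x0 r) (?I (Suc m) (?D b))"
        using Suc.IH[of "?D b" "Suc m"] Suc.prems by simp
      then show "Ck_on k (ball x0 r) (\<lambda>x. (v \<bullet> b) * ?I (Suc m) (?D b) x)"
        by (rule Ck_on_bounded_linear_comp[OF open_ball bounded_linear_mult_right])
    qed
    ultimately have "Ck_on (Suc k) (ball x0 r) (?I m \<phi>)"
      by (rule Ck_on_SucI[OF open_ball])
    then show ?case by simp
  }
qed

text \<open>By the fundamental theorem of calculus, f x - f x0 is the integral of the derivative of
  f along the segment from x0 to x. The coefficients \<open>h b\<close> are the averages of the
  partial derivatives over that segment. The ball keeps the segment inside the domain.\<close>

lemma Hadamard:
  fixes f :: "'a::euclidean_space \<Rightarrow> real"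
  assumes f: "smooth_on (ball x0 r) f"
  obtains h where "\<And>b. smooth_on (ball x0 r) (h b)"
    "\<And>x. x \<in> ball x0 r \<Longrightarrow> f x = f x0 + (\<Sum>b\<in>Basis. ((x - x0) \<bullet> b) * h b x)"
    "\<And>b. h b x0 = frechet_derivative f (at x0) b"
proof
  let ?D = "\<lambda>b x. frechet_derivative f (at x) b"
  define h where "h b x = integral {0..1} (\<lambda>t. ?D b (x0 + t *\<^sub>R (x - x0)))" for b x
  have D: "smooth_on (ball x0 r) (?D b)" for b
    by (rule smooth_on_frechet_derivative[OF f])
  show "smooth_on (ball x0 r) (h b)" for b
    using D[of b] Ck_on_integral_ray[of _ x0 r "?D b" 0] unfolding smooth_on_def h_def by simp
  show "h b x0 = frechet_derivative f (at x0) b" for b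
    by (simp add: h_def)
  fix x assume x: "x \<in> ball x0 r"
  have ray: "x0 + t *\<^sub>R (x - x0) \<in> ball x0 r" if "t \<in> {0..1}" for t :: real
    using ray_in_ball[OF x] that by simp
  have "((\<lambda>t. f (x0 + t *\<^sub>R (x - x0))) has_vector_derivative
      (\<Sum>b\<in>Basis. ((x - x0) \<bullet> b) * ?D b (x0 + t *\<^sub>R (x - x0)))) (at t within {0..1})"
    if t: "t \<in> {0..1}" for t
  proof -
    let ?y = "x0 + t *\<^sub>R (x - x0)"
    have d: "f differentiable at ?y"
      using smooth_on_differentiable[OF f ray[OF t]] .
    have "((\<lambda>t. x0 + t *\<^sub>R (x - x0)) has_vector_derivative (x - x0)) (at t within {0..1})"
      by (auto intro!: derivative_eq_intros)
    moreover have "(f has_derivative frechet_derivative f (at ?y)) (at ?y within (\<lambda>t. x0 + t *\<^sub>R (x - x0)) ` {0..1})"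
      using d by (simp add: frechet_derivative_works has_derivative_at_withinI)
    ultimately have "((f \<circ> (\<lambda>t. x0 + t *\<^sub>R (x - x0))) has_vector_derivative frechet_derivative f (at ?y) (x - x0)) (at t within {0..1})"
      by (rule vector_derivative_diff_chain_within)
    then show ?thesis
      using frechet_derivative_Basis_sum[OF d, of "x - x0"] by (simp add: o_def)
  qed
  from fundamental_theorem_of_calculus[OF _ this]
  have "((\<lambda>t. \<Sum>b\<in>Basis. ((x - x0) \<bullet> b) * ?D b (x0 + t *\<^sub>R (x - x0))) has_integral (f x - f x0)) {0..1}"
    by simp
  moreover have "((\<lambda>t. \<Sum>b\<in>Basis. ((x - x0) \<bullet> b) * ?D b (x0 + t *\<^sub>R (x - x0))) has_integral
      (\<Sum>b\<in>Basis. ((x - x0) \<bullet> b) * h b x)) {0..1}"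
  proof (intro has_integral_sum has_integral_mult_right finite_Basis)
    fix b
    have "continuous_on {0..1} (\<lambda>t. ?D b (x0 + t *\<^sub>R (x - x0)))"
      by (rule continuous_on_compose2[OF smooth_on_continuous[OF D]])
        (use ray in \<open>auto intro!: continuous_intros\<close>)
    then show "((\<lambda>t. ?D b (x0 + t *\<^sub>R (x - x0))) has_integral h b x) {0..1}"
      unfolding h_def using integrable_integral integrable_continuous_real by blast
  qed
  ultimately have "f x - f x0 = (\<Sum>b\<in>Basis. ((x - x0) \<bullet> b) * h b x)"
    by (rule has_integral_unique)
  then show "f x = f x0 + (\<Sum>b\<in>Basis. ((x - x0) \<bullet> b) * h b x)"
    by linarith
qed

section \<open>Derivations on a smooth manifold\<close>

lemma sum_fun_apply: "(\<Sum>i\<in>I. f i) x = (\<Sum>i\<in>I. f i x)"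
  for f :: "'i \<Rightarrow> 'a \<Rightarrow> 'b::comm_monoid_add"
  by (induction I rule: infinite_finite_induct) auto

context smooth_manifold
begin

lemma chart_subset: "(U, \<phi>) \<in> A \<Longrightarrow> U \<subseteq> topspace T"
  using chart_open openin_subset by blast

lemma chart_inj: "(U, \<phi>) \<in> A \<Longrightarrow> inj_on \<phi> U"
  using homeomorphic_imp_injective_map[OF chart_homeomorphism] chart_subset by (simp add: Int_absorb1)

lemma inv_chart: "(U, \<phi>) \<in> A \<Longrightarrow> x \<in> U \<Longrightarrow> inv_into U \<phi> (\<phi> x) = x"
  using chart_inj by simp

lemma chart_at:
  assumes "p \<in> topspace T"
  obtains U \<phi> where "(U, \<phi>) \<in> A" "p \<in> U"
  using assms charts_cover by blast

lemma open_chart_image: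
  assumes "(U, \<phi>) \<in> A" "openin T W"
  shows "open (\<phi> ` (U \<inter> W))"
proof -
  have "openin (top_of_set (\<phi> ` U)) (\<phi> ` (U \<inter> W))"
    using homeomorphic_imp_open_map[OF chart_homeomorphism[OF assms(1)]] assms(2)
    unfolding open_map_def by (simp add: openin_subtopology_Int2)
  then show ?thesis
    using chart_image_open[OF assms(1)] openin_open_trans by blast
qed

lemma openin_chart_preimage:
  assumes "(U, \<phi>) \<in> A" "open S"
  shows "openin T {x \<in> U. \<phi> x \<in> S}"
proof -
  have "openin (top_of_set (\<phi> ` U)) (\<phi> ` U \<inter> S)"
    using assms(2) by (simp add: openin_open_Int)
  then have "openin (subtopology T U) {x \<in> topspace (subtopology T U). \<phi> x \<in> \<phi> ` U \<inter> S}"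
    by (rule openin_continuous_map_preimage[OF homeomorphic_imp_continuous_map[OF chart_homeomorphism[OF assms(1)]]])
  also have "{x \<in> topspace (subtopology T U). \<phi> x \<in> \<phi> ` U \<inter> S} = {x \<in> U. \<phi> x \<in> S}"
    using chart_subset[OF assms(1)] by auto
  finally show ?thesis
    using chart_open[OF assms(1)] openin_trans_full by blast
qed

lemma smooth_fun_on_subset: "smooth_fun_on A W f \<Longrightarrow> W' \<subseteq> W \<Longrightarrow> smooth_fun_on A W' f"
  unfolding smooth_fun_on_def by (blast intro: smooth_on_subset)

lemma smooth_fun_onD: "smooth_fun_on A W f \<Longrightarrow> (U, \<phi>) \<in> A \<Longrightarrow> smooth_on (\<phi> ` (U \<inter> W)) (f \<circ> inv_into U \<phi>)"
  unfolding smooth_fun_on_def by blast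

text \<open>One suitable chart around each point is enough; compatibility of charts transfers
  smoothness to every other chart.\<close>

lemma smooth_fun_onI_local:
  assumes "openin T W"
    and local: "\<And>p. p \<in> W \<Longrightarrow> \<exists>U \<phi> N. (U, \<phi>) \<in> A \<and> p \<in> U \<and> openin T N \<and> p \<in> N \<and>
      smooth_on (\<phi> ` (U \<inter> N)) (f \<circ> inv_into U \<phi>)"
  shows "smooth_fun_on A W f"
  unfolding smooth_fun_on_def
proof clarify
  fix V \<psi> assume V: "(V, \<psi>) \<in> A"
  show "smooth_on (\<psi> ` (V \<inter> W)) (f \<circ> inv_into V \<psi>)"
  proof (rule smooth_on_local[OF open_chart_image[OF V assms(1)]])
    fix y assume "y \<in> \<psi> ` (V \<inter> W)"
    then obtain p where p: "p \<in> V" "p \<in> W" "y = \<psi> p"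
      by auto
    from local[OF p(2)] obtain U \<phi> N where U: "(U, \<phi>) \<in> A" and N: "p \<in> U" "openin T N" "p \<in> N"
      and f: "smooth_on (\<phi> ` (U \<inter> N)) (f \<circ> inv_into U \<phi>)"
      by blast
    let ?M = "\<psi> ` (V \<inter> (U \<inter> N))"
    have M: "open ?M"
      by (rule open_chart_image[OF V openin_Int[OF chart_open[OF U] N(2)]])
    have "smooth_on ?M (\<phi> \<circ> inv_into V \<psi>)"
      by (rule smooth_on_subset[OF charts_compatible[OF V U]]) auto
    moreover have "(\<phi> \<circ> inv_into V \<psi>) ` ?M \<subseteq> \<phi> ` (U \<inter> N)"
      using inv_chart[OF V] by auto
    ultimately have "smooth_on ?M (\<lambda>x. (f \<circ> inv_into U \<phi>) ((\<phi> \<circ> inv_into V \<psi>) x))"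
      using smooth_on_compose[OF M] f by blast
    then have "smooth_on ?M (f \<circ> inv_into V \<psi>)"
      by (rule smooth_on_cong[OF M, rotated]) (auto simp: inv_chart[OF V] inv_chart[OF U])
    then show "\<exists>N. open N \<and> y \<in> N \<and> smooth_on N (f \<circ> inv_into V \<psi>)"
      using M p N by blast
  qed
qed

lemma smooth_fun_on_cong:
  assumes "openin T W" "\<And>x. x \<in> W \<Longrightarrow> f x = h x" "smooth_fun_on A W f"
  shows "smooth_fun_on A W h"
  unfolding smooth_fun_on_def
proof clarify
  fix U \<phi> assume U: "(U, \<phi>) \<in> A"
  show "smooth_on (\<phi> ` (U \<inter> W)) (h \<circ> inv_into U \<phi>)"
    by (rule smooth_on_cong[OF open_chart_image[OF U assms(1)] _ smooth_fun_onD[OF assms(3) U]])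
      (auto simp: inv_chart[OF U] assms(2))
qed

lemma smooth_fun_on_const: "smooth_fun_on A W (\<lambda>_. c)"
  unfolding smooth_fun_on_def by (auto simp: o_def smooth_on_const)

lemma smooth_fun_on_add:
  assumes "openin T W" "smooth_fun_on A W f" "smooth_fun_on A W h"
  shows "smooth_fun_on A W (\<lambda>x. f x + h x)"
  using assms smooth_on_add[OF open_chart_image] unfolding smooth_fun_on_def o_def by fast

lemma smooth_fun_on_mult:
  assumes "openin T W" "smooth_fun_on A W f" "smooth_fun_on A W h"
  shows "smooth_fun_on A W (\<lambda>x. f x * h x)"
  using assms smooth_on_mult[OF open_chart_image] unfolding smooth_fun_on_def o_def by fast

lemma smooth_fun_on_chart_comp:
  assumes "(U, \<phi>) \<in> A" "open S" "S \<subseteq> \<phi> ` U" "smooth_on S h"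
  shows "smooth_fun_on A {x \<in> U. \<phi> x \<in> S} (\<lambda>x. h (\<phi> x))"
proof (rule smooth_fun_onI_local)
  show op: "openin T {x \<in> U. \<phi> x \<in> S}"
    by (rule openin_chart_preimage[OF assms(1,2)])
  fix p assume p: "p \<in> {x \<in> U. \<phi> x \<in> S}"
  have "smooth_on (\<phi> ` (U \<inter> {x \<in> U. \<phi> x \<in> S})) ((\<lambda>x. h (\<phi> x)) \<circ> inv_into U \<phi>)"
    by (rule smooth_on_cong[OF open_chart_image[OF assms(1) op] _ smooth_on_subset[OF assms(4)]])
      (auto simp: inv_chart[OF assms(1)])
  then show "\<exists>U' \<phi>' N. (U', \<phi>') \<in> A \<and> p \<in> U' \<and> openin T N \<and> p \<in> N \<and>
      smooth_on (\<phi>' ` (U' \<inter> N)) ((\<lambda>x. h (\<phi> x)) \<circ> inv_into U' \<phi>')"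
    using assms(1) p op by blast
qed

lemma smooth_fun_on_coordinate:
  assumes "(U, \<phi>) \<in> A"
  shows "smooth_fun_on A U (\<lambda>x. \<phi> x \<bullet> b)"
proof -
  have "smooth_fun_on A {x \<in> U. \<phi> x \<in> \<phi> ` U} (\<lambda>x. \<phi> x \<bullet> b)"
    by (intro smooth_fun_on_chart_comp[OF assms] smooth_on_bounded_linear chart_image_open[OF assms]
        bounded_linear_inner_left order_refl)
  moreover have "{x \<in> U. \<phi> x \<in> \<phi> ` U} = U"
    by blast
  ultimately show ?thesis by simp
qed

section \<open>Functions smooth near a point\<close>

lemma smooth_nearI: "openin T W \<Longrightarrow> p \<in> W \<Longrightarrow> smooth_fun_on A W f \<Longrightarrow> smooth_near T A p f"
  unfolding smooth_near_def by blast

lemma smooth_near_topspace: "smooth_near T A p f \<Longrightarrow> p \<in> topspace T"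
  unfolding smooth_near_def using openin_subset by blast

lemma smooth_near_common:
  assumes "smooth_near T A p f" "smooth_near T A p h"
  obtains W where "openin T W" "p \<in> W" "smooth_fun_on A W f" "smooth_fun_on A W h"
proof -
  obtain V W where "openin T V" "p \<in> V" "smooth_fun_on A V f" "openin T W" "p \<in> W" "smooth_fun_on A W h"
    using assms unfolding smooth_near_def by blast
  then show ?thesis
    using that[of "V \<inter> W"] smooth_fun_on_subset by (simp add: openin_Int)
qed

lemma smooth_near_const: "p \<in> topspace T \<Longrightarrow> smooth_near T A p (\<lambda>_. c)"
  using smooth_nearI[OF openin_topspace _ smooth_fun_on_const] by blast

lemma smooth_near_add:
  "smooth_near T A p f \<Longrightarrow> smooth_near T A p h \<Longrightarrow> smooth_near T A p (\<lambda>x. f x + h x)"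
  by (erule (1) smooth_near_common) (blast intro: smooth_nearI smooth_fun_on_add)

lemma smooth_near_mult:
  "smooth_near T A p f \<Longrightarrow> smooth_near T A p h \<Longrightarrow> smooth_near T A p (\<lambda>x. f x * h x)"
  by (erule (1) smooth_near_common) (blast intro: smooth_nearI smooth_fun_on_mult)

lemma smooth_near_cmult: "smooth_near T A p f \<Longrightarrow> smooth_near T A p (\<lambda>x. c * f x)"
  using smooth_near_mult[OF smooth_near_const] smooth_near_topspace by blast

lemma smooth_near_cong:
  assumes "openin T N" "p \<in> N" "\<And>x. x \<in> N \<Longrightarrow> f x = h x" "smooth_near T A p f"
  shows "smooth_near T A p h"
proof -
  obtain W where W: "openin T W" "p \<in> W" "smooth_fun_on A W f"
    using assms(4) unfolding smooth_near_def by blast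
  have "smooth_fun_on A (N \<inter> W) h"
    by (rule smooth_fun_on_cong[OF _ _ smooth_fun_on_subset[OF W(3)]]) (use assms W in auto)
  then show ?thesis
    using assms W smooth_nearI[of "N \<inter> W"] by blast
qed

lemma smooth_near_sum:
  "p \<in> topspace T \<Longrightarrow> (\<And>i. i \<in> I \<Longrightarrow> smooth_near T A p (f i)) \<Longrightarrow>
    smooth_near T A p (\<lambda>x. \<Sum>i\<in>I. f i x)"
  by (induction I rule: infinite_finite_induct) (simp_all add: smooth_near_const smooth_near_add)

section \<open>Tangent vectors: locality and coordinates\<close>

lemma tangent_spaceI:
  assumes "\<And>f h. smooth_near T A p f \<Longrightarrow> smooth_near T A p h \<Longrightarrow> v (\<lambda>x. f x + h x) = v f + v h"
    and "\<And>f h. smooth_near T A p f \<Longrightarrow> smooth_near T A p h \<Longrightarrow>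
      v (\<lambda>x. f x * h x) = f p * v h + h p * v f"
    and "\<And>c f. smooth_near T A p f \<Longrightarrow> v (\<lambda>x. c * f x) = c * v f"
    and "\<And>f. \<not> smooth_near T A p f \<Longrightarrow> v f = 0"
  shows "v \<in> tangent_space T A p"
  unfolding tangent_space_def using assms by blast

lemma tangent_add:
  "v \<in> tangent_space T A p \<Longrightarrow> smooth_near T A p f \<Longrightarrow> smooth_near T A p h \<Longrightarrow>
    v (\<lambda>x. f x + h x) = v f + v h"
  unfolding tangent_space_def by blast

lemma tangent_mult:
  "v \<in> tangent_space T A p \<Longrightarrow> smooth_near T A p f \<Longrightarrow> smooth_near T A p h \<Longrightarrow>
    v (\<lambda>x. f x * h x) = f p * v h + h p * v f"
  unfolding tangent_space_def by blast

lemma tangent_cmult: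
  "v \<in> tangent_space T A p \<Longrightarrow> smooth_near T A p f \<Longrightarrow> v (\<lambda>x. c * f x) = c * v f"
  unfolding tangent_space_def by blast

lemma tangent_not_smooth: "v \<in> tangent_space T A p \<Longrightarrow> \<not> smooth_near T A p f \<Longrightarrow> v f = 0"
  unfolding tangent_space_def by blast

lemma tangent_const:
  assumes "v \<in> tangent_space T A p" "p \<in> topspace T"
  shows "v (\<lambda>_. c) = 0"
proof -
  have one: "smooth_near T A p (\<lambda>_. 1)"
    by (rule smooth_near_const[OF assms(2)])
  \<comment> \<open>The Leibniz rule for 1 * 1 gives v 1 = 2 * v 1.\<close>
  have "v (\<lambda>_. 1) = 0"
    using tangent_mult[OF assms(1) one one] by simp
  then show ?thesis
    using tangent_cmult[OF assms(1) one, of c] by simp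
qed

lemma tangent_local:
  assumes v: "v \<in> tangent_space T A p" and N: "openin T N" "p \<in> N"
    and eq: "\<And>x. x \<in> N \<Longrightarrow> f x = h x" and f: "smooth_near T A p f"
  shows "v f = v h"
proof -
  have h: "smooth_near T A p h"
    by (rule smooth_near_cong[OF N eq f])
  \<comment> \<open>The cutoff \<open>?u\<close> may jump at the boundary of N, because only
    smoothness near p is asked of it. Then \<open>?d = ?u * ?d\<close> with both factors vanishing
    at p, so the Leibniz rule kills \<open>v ?d\<close>.\<close>
  let ?d = "\<lambda>x. f x + (-1) * h x" and ?u = "\<lambda>x. if x \<in> N then 0 else 1 :: real"
  have d: "smooth_near T A p ?d"
    by (rule smooth_near_add[OF f smooth_near_cmult[OF h]])
  have u: "smooth_near T A p ?u"
    by (rule smooth_near_cong[OF N _ smooth_near_const[of p 0]])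
      (use N openin_subset in auto)
  have "(\<lambda>x. ?u x * ?d x) = ?d"
    using eq by auto
  then have "v ?d = 0"
    using tangent_mult[OF v u d] N eq by simp
  moreover have "(\<lambda>x. ?d x + h x) = f"
    by auto
  ultimately show ?thesis
    using tangent_add[OF v d h] by simp
qed

lemma tangent_sum:
  assumes "v \<in> tangent_space T A p" "p \<in> topspace T"
  shows "(\<And>i. i \<in> I \<Longrightarrow> smooth_near T A p (f i)) \<Longrightarrow> v (\<lambda>x. \<Sum>i\<in>I. f i x) = (\<Sum>i\<in>I. v (f i))"
  by (induction I rule: infinite_finite_induct)
    (simp_all add: tangent_const[OF assms] tangent_add[OF assms(1)] smooth_near_sum[OF assms(2)])

lemma tangent_subspace: "p \<in> topspace T \<Longrightarrow> subspace (tangent_space T A p)"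
  by (rule subspaceI; rule tangent_spaceI)
    (simp_all add: tangent_add tangent_mult tangent_cmult tangent_not_smooth scaleR_fun_def algebra_simps)

text \<open>Hadamard's lemma in a ball around \<phi> p writes f near p as a constant plus a sum of
  products of a shifted coordinate and a smooth function. A derivation kills the constant, and since
  each shifted coordinate is 0 at p, the Leibniz rule leaves one term per product, with the partial
  derivative of f as factor.\<close>

lemma tangent_coordinates:
  assumes U: "(U, \<phi>) \<in> A" and p: "p \<in> U" and v: "v \<in> tangent_space T A p" and f: "smooth_near T A p f"
  shows "v f = (\<Sum>b\<in>Basis. v (\<lambda>x. \<phi> x \<bullet> b) * frechet_derivative (f \<circ> inv_into U \<phi>) (at (\<phi> p)) b)"
proof -
  have pT: "p \<in> topspace T"
    using p chart_subset[OF U] by blast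
  obtain W where W: "openin T W" "p \<in> W" "smooth_fun_on A W f"
    using f unfolding smooth_near_def by blast
  let ?F = "f \<circ> inv_into U \<phi>"
  have "open (\<phi> ` (U \<inter> W))" "\<phi> p \<in> \<phi> ` (U \<inter> W)"
    using open_chart_image[OF U W(1)] p W(2) by auto
  then obtain r where r: "r > 0" "ball (\<phi> p) r \<subseteq> \<phi> ` (U \<inter> W)"
    using openE by blast
  have "smooth_on (ball (\<phi> p) r) ?F"
    by (rule smooth_on_subset[OF smooth_fun_onD[OF W(3) U] r(2)])
  then obtain h where h: "\<And>b. smooth_on (ball (\<phi> p) r) (h b)"
    and F: "\<And>x. x \<in> ball (\<phi> p) r \<Longrightarrow> ?F x = ?F (\<phi> p) + (\<Sum>b\<in>Basis. ((x - \<phi> p) \<bullet> b) * h b x)"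
    and hp: "\<And>b. h b (\<phi> p) = frechet_derivative ?F (at (\<phi> p)) b"
    using Hadamard by blast
  let ?N = "{x \<in> U. \<phi> x \<in> ball (\<phi> p) r}"
  have N: "openin T ?N" "p \<in> ?N"
    using openin_chart_preimage[OF U open_ball] p r(1) by auto
  have h_near: "smooth_near T A p (\<lambda>x. h b (\<phi> x))" for b
    by (rule smooth_nearI[OF N smooth_fun_on_chart_comp[OF U open_ball _ h]]) (use r(2) in auto)
  have coord_near: "smooth_near T A p (\<lambda>x. \<phi> x \<bullet> b)" for b
    by (rule smooth_nearI[OF chart_open[OF U] p smooth_fun_on_coordinate[OF U]])
  \<comment> \<open>The coordinate is shifted to vanish at p, and written as a sum so that
    \<open>tangent_add\<close> applies. The final simplification must preserve this shape, hence the
    deleted rule \<open>add_uminus_conv_diff\<close>.\<close>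
  let ?c = "\<lambda>b x. \<phi> x \<bullet> b + - (\<phi> p \<bullet> b)"
  have c_near: "smooth_near T A p (?c b)" for b
    by (rule smooth_near_add[OF coord_near smooth_near_const[OF pT]])
  have vc: "v (?c b) = v (\<lambda>x. \<phi> x \<bullet> b)" for b
    unfolding tangent_add[OF v coord_near smooth_near_const[OF pT]] tangent_const[OF v pT] by simp
  have near: "smooth_near T A p (\<lambda>x. ?c b x * h b (\<phi> x))" for b
    by (rule smooth_near_mult[OF c_near h_near])
  have "v f = v (\<lambda>x. f p + (\<Sum>b\<in>Basis. ?c b x * h b (\<phi> x)))"
  proof (rule tangent_local[OF v N _ f])
    fix x assume "x \<in> ?N"
    then show "f x = f p + (\<Sum>b\<in>Basis. ?c b x * h b (\<phi> x))"
      using F[of "\<phi> x"] p by (simp add: inv_chart[OF U] inner_diff_left)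
  qed
  also have "\<dots> = (\<Sum>b\<in>Basis. v (\<lambda>x. ?c b x * h b (\<phi> x)))"
    unfolding tangent_add[OF v smooth_near_const[OF pT] smooth_near_sum[OF pT near]]
      tangent_const[OF v pT] tangent_sum[OF v pT near] by simp
  also have "\<dots> = (\<Sum>b\<in>Basis. v (\<lambda>x. \<phi> x \<bullet> b) * frechet_derivative ?F (at (\<phi> p)) b)"
    by (rule sum.cong) (simp_all add: tangent_mult[OF v c_near h_near] vc hp del: add_uminus_conv_diff)
  finally show ?thesis .
qed

lemma tangent_space_finite_dim:
  assumes "p \<in> topspace T"
  obtains D where "finite D" "tangent_space T A p \<subseteq> span D"
proof -
  obtain U \<phi> where U: "(U, \<phi>) \<in> A" "p \<in> U"
    using chart_at assms by blast
  \<comment> \<open>The partial derivatives at p, set to 0 on functions not smooth near p as tangent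
    vectors are. The expansion of v then holds as an equality of functions.\<close>
  define d where "d b f = (if smooth_near T A p f
    then frechet_derivative (f \<circ> inv_into U \<phi>) (at (\<phi> p)) b else 0)" for b f
  have "v \<in> span (d ` Basis)" if v: "v \<in> tangent_space T A p" for v
  proof -
    have "v = (\<Sum>b\<in>Basis. v (\<lambda>x. \<phi> x \<bullet> b) *\<^sub>R d b)"
    proof
      fix f
      show "v f = (\<Sum>b\<in>Basis. v (\<lambda>x. \<phi> x \<bullet> b) *\<^sub>R d b) f"
        by (cases "smooth_near T A p f")
          (simp_all add: tangent_coordinates[OF U v, of f] tangent_not_smooth[OF v]
            sum_fun_apply scaleR_fun_def d_def)
    qed
    also have "\<dots> \<in> span (d ` Basis)"
      by (intro span_sum span_scale span_base imageI)
    finally show ?thesis .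
  qed
  then show ?thesis
    using that[of "d ` Basis"] by auto
qed

end

section \<open>The trace of an infinitesimal similarity\<close>

text \<open>Stands for the metric at the identity read on left-invariant fields. Linearity is in the
  first argument and passes to the second by symmetry; no definiteness is assumed.\<close>

locale nondegenerate_form =
  fixes V :: "'v::real_vector set" and \<beta> :: "'v \<Rightarrow> 'v \<Rightarrow> real"
  assumes subspace_V: "subspace V"
    and \<beta>_commute: "u \<in> V \<Longrightarrow> v \<in> V \<Longrightarrow> \<beta> u v = \<beta> v u"
    and \<beta>_linear: "u \<in> V \<Longrightarrow> v \<in> V \<Longrightarrow> w \<in> V \<Longrightarrow> \<beta> (c *\<^sub>R u + d *\<^sub>R v) w = c * \<beta> u w + d * \<beta> v w"
    and \<beta>_nondegenerate: "u \<in> V \<Longrightarrow> (\<And>v. v \<in> V \<Longrightarrow> \<beta> u v = 0) \<Longrightarrow> u = 0"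
begin

lemma \<beta>_add: "u \<in> V \<Longrightarrow> v \<in> V \<Longrightarrow> w \<in> V \<Longrightarrow> \<beta> (u + v) w = \<beta> u w + \<beta> v w"
  using \<beta>_linear[of u v w 1 1] by simp

lemma \<beta>_scaleR: "u \<in> V \<Longrightarrow> w \<in> V \<Longrightarrow> \<beta> (c *\<^sub>R u) w = c * \<beta> u w"
  using \<beta>_linear[of u u w c 0] by simp

lemma \<beta>_zero: "w \<in> V \<Longrightarrow> \<beta> 0 w = 0"
  using \<beta>_scaleR[of 0 w 0] subspace_0[OF subspace_V] by simp

lemma sum_in_V: "(\<And>i. i \<in> I \<Longrightarrow> f i \<in> V) \<Longrightarrow> (\<Sum>i\<in>I. c i *\<^sub>R f i) \<in> V"
  by (intro subspace_sum subspace_V subspace_mul)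

lemma \<beta>_sum:
  assumes "\<And>i. i \<in> I \<Longrightarrow> f i \<in> V" "w \<in> V"
  shows "\<beta> (\<Sum>i\<in>I. c i *\<^sub>R f i) w = (\<Sum>i\<in>I. c i * \<beta> (f i) w)"
  using assms
  by (induction I rule: infinite_finite_induct)
    (simp_all add: \<beta>_zero \<beta>_add \<beta>_scaleR subspace_mul[OF subspace_V] sum_in_V)

text \<open>Nondegeneracy makes the map from u to its pairings with the basis injective, and a
  dimension count makes it surjective. The dual vectors are the preimages of the indicator functions
  of the basis elements.\<close>

lemma dual_basis:
  assumes B: "B \<subseteq> V" "independent B" "V \<subseteq> span B" "finite B"
  obtains e where "\<And>b. b \<in> B \<Longrightarrow> e b \<in> V" "\<And>a b. a \<in> B \<Longrightarrow> b \<in> B \<Longrightarrow> \<beta> a (e b) = (if a = b then 1 else 0)"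
proof -
  \<comment> \<open>Cut off outside B, so that its values lie in the span of the finitely many
    \<open>\<delta> a\<close>.\<close>
  define \<Phi> where "\<Phi> u = (\<lambda>b. if b \<in> B then \<beta> u b else 0)" for u
  define \<delta> where "\<delta> a = (\<lambda>b. if b = a then 1 else 0 :: real)" for a :: 'v
  have \<Phi>_sum: "(\<Sum>b\<in>B. c b *\<^sub>R \<Phi> b) = \<Phi> (\<Sum>b\<in>B. c b *\<^sub>R b)" for c
    using B(1) \<beta>_sum[of B "\<lambda>b. b" _ c]
    by (auto simp: fun_eq_iff sum_fun_apply scaleR_fun_def \<Phi>_def subset_iff)
  have in_V: "(\<Sum>b\<in>B. c b *\<^sub>R b) \<in> V" for c
    using sum_in_V[of B "\<lambda>b. b" c] B(1) by blast
  have kernel: "u = 0" if u: "u \<in> V" and 0: "\<Phi> u = 0" for u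
  proof (rule \<beta>_nondegenerate[OF u])
    fix v assume "v \<in> V"
    then obtain c where c: "v = (\<Sum>b\<in>B. c b *\<^sub>R b)"
      using B(3) span_finite[OF B(4)] by blast
    have "\<beta> b u = 0" if "b \<in> B" for b
      using that 0 u B(1) \<beta>_commute[of b u] by (auto simp: \<Phi>_def fun_eq_iff split: if_splits)
    then have "\<beta> v u = 0"
      unfolding c using \<beta>_sum[of B "\<lambda>b. b" u c] B(1) u by (simp add: subset_iff)
    then show "\<beta> u v = 0"
      using \<beta>_commute u \<open>v \<in> V\<close> by simp
  qed
  have zero: "c b = 0" if "(\<Sum>b\<in>B. c b *\<^sub>R \<Phi> b) = 0" "b \<in> B" for c b
  proof -
    have "(\<Sum>b\<in>B. c b *\<^sub>R b) = 0"
      using that(1) kernel[OF in_V] unfolding \<Phi>_sum by blast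
    then show ?thesis
      using B(2,4) that(2) by (auto simp: dependent_finite)
  qed
  have inj: "inj_on \<Phi> B"
  proof (rule inj_onI)
    fix a b assume ab: "a \<in> B" "b \<in> B" "\<Phi> a = \<Phi> b"
    have ab_V: "a \<in> V" "b \<in> V"
      using ab B(1) by auto
    then have "a + (-1) *\<^sub>R b \<in> V"
      by (intro subspace_add subspace_mul subspace_V)
    moreover have "\<Phi> (a + (-1) *\<^sub>R b) = 0"
    proof
      fix x
      show "\<Phi> (a + (-1) *\<^sub>R b) x = 0 x"
        using fun_cong[OF ab(3), of x] \<beta>_linear[OF ab_V, of x 1 "-1"] B(1)
        by (auto simp: \<Phi>_def subset_iff)
    qed
    ultimately have "a + (-1) *\<^sub>R b = 0"
      by (rule kernel)
    then show "a = b"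
      by simp
  qed
  have ind: "independent (\<Phi> ` B)"
  proof (rule independent_if_scalars_zero)
    show "finite (\<Phi> ` B)" using B(4) by simp
    fix f x assume "(\<Sum>x\<in>\<Phi> ` B. f x *\<^sub>R x) = 0" "x \<in> \<Phi> ` B"
    then show "f x = 0"
      using zero[of "\<lambda>b. f (\<Phi> b)"] by (auto simp: sum.reindex[OF inj] o_def)
  qed
  have \<Phi>_span: "\<Phi> ` B \<subseteq> span (\<delta> ` B)"
  proof clarify
    fix b assume "b \<in> B"
    have "\<Phi> b = (\<Sum>a\<in>B. \<beta> b a *\<^sub>R \<delta> a)"
      using B(4) by (auto simp: fun_eq_iff sum_fun_apply scaleR_fun_def \<Phi>_def \<delta>_def if_distrib[of "\<lambda>t. _ * t"]
          cong: if_cong)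
    then show "\<Phi> b \<in> span (\<delta> ` B)"
      by (simp add: span_sum span_scale span_base)
  qed
  have \<delta>_span: "\<delta> a \<in> span (\<Phi> ` B)" if a: "a \<in> B" for a
  proof (rule ccontr)
    assume not: "\<delta> a \<notin> span (\<Phi> ` B)"
    have "insert (\<delta> a) (\<Phi> ` B) \<subseteq> span (\<delta> ` B)"
      using \<Phi>_span a by (simp add: span_base)
    then have "card (insert (\<delta> a) (\<Phi> ` B)) \<le> card (\<delta> ` B)"
      using independent_span_bound[OF finite_imageI[OF B(4)] independent_insertI[OF not ind]] by blast
    moreover have "\<delta> a \<notin> \<Phi> ` B"
      using not by (rule contrapos_nn) (rule span_base)
    ultimately show False
      using B(4) card_image[OF inj] card_image_le[OF B(4), of \<delta>] by simp
  qed
  have "\<exists>u\<in>V. \<Phi> u = \<delta> a" if "a \<in> B" for a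
  proof -
    have "\<exists>c. \<delta> a = (\<Sum>x\<in>\<Phi> ` B. c x *\<^sub>R x)"
      using \<delta>_span[OF that] span_finite[of "\<Phi> ` B"] B(4) by auto
    then obtain c where "\<delta> a = (\<Sum>x\<in>\<Phi> ` B. c x *\<^sub>R x)" ..
    also have "\<dots> = \<Phi> (\<Sum>b\<in>B. c (\<Phi> b) *\<^sub>R b)"
      unfolding \<Phi>_sum[symmetric] by (simp add: sum.reindex[OF inj] o_def)
    finally show ?thesis
      using in_V by metis
  qed
  then obtain e where e: "\<And>a. a \<in> B \<Longrightarrow> e a \<in> V \<and> \<Phi> (e a) = \<delta> a"
    by metis
  show ?thesis
  proof
    fix b assume b: "b \<in> B"
    then show "e b \<in> V" using e by blast
    fix a assume a: "a \<in> B"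
    have "\<beta> (e b) a = \<Phi> (e b) a"
      using a by (simp add: \<Phi>_def)
    then show "\<beta> a (e b) = (if a = b then 1 else 0)"
      using a b e B(1) \<beta>_commute[of a "e b"] by (auto simp: \<delta>_def)
  qed
qed

text \<open>
  In terms of dual bases \<open>b\<close> and \<open>e b\<close>, both \<open>\<Sum>b. \<beta> (F b) (e b)\<close> and \<open>\<Sum>b. \<beta> b (F (e b))\<close> are the trace,
  because the coefficients \<open>\<beta> (e a) (e b)\<close> of the \<open>e b\<close> are symmetric.
\<close>

lemma trace_similarity:
  assumes F: "\<And>u. u \<in> V \<Longrightarrow> F u \<in> V"
    and F_linear: "\<And>u v c d. u \<in> V \<Longrightarrow> v \<in> V \<Longrightarrow> F (c *\<^sub>R u + d *\<^sub>R v) = c *\<^sub>R F u + d *\<^sub>R F v"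
    and F_\<beta>: "\<And>u v. u \<in> V \<Longrightarrow> v \<in> V \<Longrightarrow> \<beta> (F u) v + \<beta> u (F v) = k * \<beta> u v"
    and B: "B \<subseteq> V" "independent B" "V \<subseteq> span B" "finite B"
  shows "2 * (\<Sum>b\<in>B. representation B (F b) b) = k * card B"
proof -
  obtain e where e: "\<And>b. b \<in> B \<Longrightarrow> e b \<in> V"
    and dual: "\<And>a b. a \<in> B \<Longrightarrow> b \<in> B \<Longrightarrow> \<beta> a (e b) = (if a = b then 1 else 0)"
    using dual_basis[OF B] by blast
  have BV: "b \<in> V" if "b \<in> B" for b
    using that B(1) by blast
  \<comment> \<open>Pairing with \<open>e b\<close> extracts the coordinate along b, which turns
    \<open>representation\<close> into values of \<beta>.\<close>
  have expand: "u = (\<Sum>a\<in>B. \<beta> u (e a) *\<^sub>R a)" "representation B u b = \<beta> u (e b)"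
    if u: "u \<in> V" and b: "b \<in> B" for u b
  proof -
    have rep: "u = (\<Sum>a\<in>B. representation B u a *\<^sub>R a)"
      using sum_representation_eq[OF B(2) _ B(4) order_refl, of u] u B(3) by auto
    have rep_eq: "\<beta> u (e b) = representation B u b" if "b \<in> B" for b
    proof -
      have "\<beta> u (e b) = (\<Sum>a\<in>B. representation B u a * \<beta> a (e b))"
        using \<beta>_sum[of B "\<lambda>a. a" "e b" "representation B u"] BV e[OF that] rep by simp
      also have "\<dots> = representation B u b"
        using that B(4) by (simp add: dual if_distrib[of "\<lambda>t. _ * t"] cong: if_cong)
      finally show ?thesis .
    qed
    show "representation B u b = \<beta> u (e b)"
      using rep_eq[OF b] by simp
    have "(\<Sum>a\<in>B. representation B u a *\<^sub>R a) = (\<Sum>a\<in>B. \<beta> u (e a) *\<^sub>R a)"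
      by (rule sum.cong) (simp_all add: rep_eq)
    with rep show "u = (\<Sum>a\<in>B. \<beta> u (e a) *\<^sub>R a)" by simp
  qed
  have F_sum: "F (\<Sum>i\<in>I. c i *\<^sub>R f i) = (\<Sum>i\<in>I. c i *\<^sub>R F (f i))"
    if "\<And>i. i \<in> I \<Longrightarrow> f i \<in> V" for I :: "'v set" and f and c
    using that
  proof (induction I rule: infinite_finite_induct)
    case (insert i I)
    then show ?case
      using F_linear[of "f i" "\<Sum>i\<in>I. c i *\<^sub>R f i" "c i" 1] sum_in_V[of I f c] by simp
  \<comment> \<open>Zero scalars in \<open>F_linear\<close> yield \<open>F 0 = 0\<close>; this
    settles the empty and the infinite index set.\<close>
  qed (use F_linear[of 0 0 0 0] subspace_0[OF subspace_V] in simp_all)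
  \<comment> \<open>Here \<open>e b\<close> is expanded in the basis; after the sums are swapped,
    \<open>e a\<close> is folded back by the same expansion.\<close>
  have "(\<Sum>b\<in>B. \<beta> b (F (e b))) = (\<Sum>b\<in>B. \<Sum>a\<in>B. \<beta> (e b) (e a) * \<beta> (F a) b)"
  proof (rule sum.cong)
    fix b assume b: "b \<in> B"
    have "F (e b) = (\<Sum>a\<in>B. \<beta> (e b) (e a) *\<^sub>R F a)"
      using expand(1)[OF e[OF b] b] F_sum[of B "\<lambda>a. a" "\<lambda>a. \<beta> (e b) (e a)"] BV by simp
    then have "\<beta> (F (e b)) b = (\<Sum>a\<in>B. \<beta> (e b) (e a) * \<beta> (F a) b)"
      using \<beta>_sum[of B F b "\<lambda>a. \<beta> (e b) (e a)"] b BV F by simp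
    then show "\<beta> b (F (e b)) = (\<Sum>a\<in>B. \<beta> (e b) (e a) * \<beta> (F a) b)"
      using b e F BV \<beta>_commute[of b "F (e b)"] by simp
  qed simp
  also have "\<dots> = (\<Sum>a\<in>B. \<Sum>b\<in>B. \<beta> (e a) (e b) * \<beta> b (F a))"
    using e F BV \<beta>_commute by (subst sum.swap) (auto intro!: sum.cong)
  also have "\<dots> = (\<Sum>a\<in>B. \<beta> (F a) (e a))"
  proof (rule sum.cong)
    fix a assume a: "a \<in> B"
    have "\<beta> (e a) (F a) = (\<Sum>b\<in>B. \<beta> (e a) (e b) * \<beta> b (F a))"
      using \<beta>_sum[of B "\<lambda>b. b" "F a" "\<lambda>b. \<beta> (e a) (e b)"] expand(1)[OF e[OF a] a] BV F a by simp
    then show "(\<Sum>b\<in>B. \<beta> (e a) (e b) * \<beta> b (F a)) = \<beta> (F a) (e a)"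
      using a e F BV \<beta>_commute[of "e a" "F a"] by simp
  qed simp
  finally have eq: "(\<Sum>b\<in>B. \<beta> b (F (e b))) = (\<Sum>b\<in>B. \<beta> (F b) (e b))" .
  \<comment> \<open>\<open>F_\<beta>\<close> for the pair b, \<open>e b\<close>: every summand
    equals k because \<beta> b (e b) = 1.\<close>
  have "(\<Sum>b\<in>B. \<beta> (F b) (e b)) + (\<Sum>b\<in>B. \<beta> b (F (e b))) = (\<Sum>b\<in>B. k)"
    unfolding sum.distrib[symmetric] using F_\<beta> BV e dual by (intro sum.cong) auto
  moreover have "(\<Sum>b\<in>B. representation B (F b) b) = (\<Sum>b\<in>B. \<beta> (F b) (e b))"
    using expand(2)[OF F[OF BV]] by (intro sum.cong) auto
  ultimately show ?thesis
    using eq by simp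
qed

end

section \<open>The Lie bracket of vector fields\<close>

context smooth_manifold
begin

lemma vector_field_tangent: "X \<in> vector_fields T A \<Longrightarrow> p \<in> topspace T \<Longrightarrow> X p \<in> tangent_space T A p"
  unfolding vector_fields_def by blast

lemma vector_field_outside: "X \<in> vector_fields T A \<Longrightarrow> p \<notin> topspace T \<Longrightarrow> X p = 0"
  unfolding vector_fields_def by blast

lemma vector_field_smooth:
  "X \<in> vector_fields T A \<Longrightarrow> openin T W \<Longrightarrow> smooth_fun_on A W f \<Longrightarrow> smooth_fun_on A W (\<lambda>p. X p f)"
  unfolding vector_fields_def by blast

lemma vector_field_smooth_near:
  "X \<in> vector_fields T A \<Longrightarrow> smooth_near T A p f \<Longrightarrow> smooth_near T A p (\<lambda>q. X q f)"
  unfolding smooth_near_def using vector_field_smooth by blast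

lemma vector_fields_subspace: "subspace (vector_fields T A)"
proof (rule subspaceI)
  show "0 \<in> vector_fields T A"
    unfolding vector_fields_def using subspace_0[OF tangent_subspace] by (simp add: smooth_fun_on_const)
next
  fix X Y assume XY: "X \<in> vector_fields T A" "Y \<in> vector_fields T A"
  then show "X + Y \<in> vector_fields T A"
    unfolding vector_fields_def using subspace_add[OF tangent_subspace] by (simp add: smooth_fun_on_add)
next
  fix X c assume X: "X \<in> vector_fields T A"
  then show "c *\<^sub>R X \<in> vector_fields T A"
    unfolding vector_fields_def using subspace_mul[OF tangent_subspace] smooth_fun_on_mult[OF _ smooth_fun_on_const]
    by (simp add: scaleR_fun_def zero_fun_def)
qed

lemma lie_bracket_apply:
  "smooth_near T A p f \<Longrightarrow> lie_bracket T A X Y p f = X p (\<lambda>q. Y q f) - Y p (\<lambda>q. X q f)"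
  by (simp add: lie_bracket_def)

text \<open>Additivity of \<open>X q\<close> is available only where f and h are smooth, hence for q
  near p; locality of v makes that sufficient. The next two lemmas follow the same pattern, and
  together they show that a bracket is a derivation.\<close>

lemma vector_field_apply_add:
  assumes X: "X \<in> vector_fields T A" and v: "v \<in> tangent_space T A p"
    and f: "smooth_near T A p f" and h: "smooth_near T A p h"
  shows "v (\<lambda>q. X q (\<lambda>x. f x + h x)) = v (\<lambda>q. X q f) + v (\<lambda>q. X q h)"
proof -
  obtain W where W: "openin T W" "p \<in> W" "smooth_fun_on A W f" "smooth_fun_on A W h"
    using smooth_near_common[OF f h] .
  have "v (\<lambda>q. X q (\<lambda>x. f x + h x)) = v (\<lambda>q. X q f + X q h)"
  proof (rule tangent_local[OF v W(1,2)])
    show "smooth_near T A p (\<lambda>q. X q (\<lambda>x. f x + h x))"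
      by (intro vector_field_smooth_near[OF X] smooth_near_add f h)
    fix q assume q: "q \<in> W"
    then have "X q \<in> tangent_space T A q"
      using vector_field_tangent[OF X] openin_subset[OF W(1)] by blast
    then show "X q (\<lambda>x. f x + h x) = X q f + X q h"
      by (rule tangent_add) (use W q smooth_nearI in blast)+
  qed
  also have "\<dots> = v (\<lambda>q. X q f) + v (\<lambda>q. X q h)"
    by (intro tangent_add[OF v] vector_field_smooth_near[OF X] f h)
  finally show ?thesis .
qed

lemma vector_field_apply_cmult:
  assumes X: "X \<in> vector_fields T A" and v: "v \<in> tangent_space T A p" and f: "smooth_near T A p f"
  shows "v (\<lambda>q. X q (\<lambda>x. c * f x)) = c * v (\<lambda>q. X q f)"
proof -
  obtain W where W: "openin T W" "p \<in> W" "smooth_fun_on A W f"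
    using f unfolding smooth_near_def by blast
  have "v (\<lambda>q. X q (\<lambda>x. c * f x)) = v (\<lambda>q. c * X q f)"
  proof (rule tangent_local[OF v W(1,2)])
    show "smooth_near T A p (\<lambda>q. X q (\<lambda>x. c * f x))"
      by (intro vector_field_smooth_near[OF X] smooth_near_cmult f)
    fix q assume q: "q \<in> W"
    then have "X q \<in> tangent_space T A q"
      using vector_field_tangent[OF X] openin_subset[OF W(1)] by blast
    then show "X q (\<lambda>x. c * f x) = c * X q f"
      by (rule tangent_cmult) (use W q smooth_nearI in blast)
  qed
  also have "\<dots> = c * v (\<lambda>q. X q f)"
    by (intro tangent_cmult[OF v] vector_field_smooth_near[OF X] f)
  finally show ?thesis .
qed

text \<open>The cross terms \<open>X p h * v f\<close> and \<open>X p f * v h\<close> obstruct the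
  Leibniz rule for a composite of two fields. For v = Y p their sum is symmetric in X and Y, so it
  cancels in the bracket.\<close>

lemma vector_field_apply_mult:
  assumes X: "X \<in> vector_fields T A" and v: "v \<in> tangent_space T A p"
    and f: "smooth_near T A p f" and h: "smooth_near T A p h"
  shows "v (\<lambda>q. X q (\<lambda>x. f x * h x)) =
    (f p * v (\<lambda>q. X q h) + X p h * v f) + (h p * v (\<lambda>q. X q f) + X p f * v h)"
proof -
  obtain W where W: "openin T W" "p \<in> W" "smooth_fun_on A W f" "smooth_fun_on A W h"
    using smooth_near_common[OF f h] .
  note near = vector_field_smooth_near[OF X f] vector_field_smooth_near[OF X h]
  have "v (\<lambda>q. X q (\<lambda>x. f x * h x)) = v (\<lambda>q. f q * X q h + h q * X q f)"
  proof (rule tangent_local[OF v W(1,2)])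
    show "smooth_near T A p (\<lambda>q. X q (\<lambda>x. f x * h x))"
      by (intro vector_field_smooth_near[OF X] smooth_near_mult f h)
    fix q assume q: "q \<in> W"
    then have "X q \<in> tangent_space T A q"
      using vector_field_tangent[OF X] openin_subset[OF W(1)] by blast
    then show "X q (\<lambda>x. f x * h x) = f q * X q h + h q * X q f"
      by (rule tangent_mult) (use W q smooth_nearI in blast)+
  qed
  also have "\<dots> = (f p * v (\<lambda>q. X q h) + X p h * v f) + (h p * v (\<lambda>q. X q f) + X p f * v h)"
    unfolding tangent_add[OF v smooth_near_mult[OF f near(2)] smooth_near_mult[OF h near(1)]]
      tangent_mult[OF v f near(2)] tangent_mult[OF v h near(1)] ..
  finally show ?thesis .
qed

lemma lie_bracket_tangent:
  assumes X: "X \<in> vector_fields T A" and Y: "Y \<in> vector_fields T A" and p: "p \<in> topspace T"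
  shows "lie_bracket T A X Y p \<in> tangent_space T A p"
proof (rule tangent_spaceI)
  note Xp = vector_field_tangent[OF X p] and Yp = vector_field_tangent[OF Y p]
  fix f h assume f: "smooth_near T A p f" and h: "smooth_near T A p h"
  show "lie_bracket T A X Y p (\<lambda>x. f x + h x) = lie_bracket T A X Y p f + lie_bracket T A X Y p h"
    using vector_field_apply_add[OF X Yp f h] vector_field_apply_add[OF Y Xp f h]
    by (simp add: lie_bracket_apply f h smooth_near_add)
  show "lie_bracket T A X Y p (\<lambda>x. f x * h x) =
      f p * lie_bracket T A X Y p h + h p * lie_bracket T A X Y p f"
    using vector_field_apply_mult[OF X Yp f h] vector_field_apply_mult[OF Y Xp f h]
    by (simp add: lie_bracket_apply f h smooth_near_mult algebra_simps)
next
  note Xp = vector_field_tangent[OF X p] and Yp = vector_field_tangent[OF Y p]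
  fix c f assume f: "smooth_near T A p f"
  show "lie_bracket T A X Y p (\<lambda>x. c * f x) = c * lie_bracket T A X Y p f"
    using vector_field_apply_cmult[OF X Yp f] vector_field_apply_cmult[OF Y Xp f]
    by (simp add: lie_bracket_apply f smooth_near_cmult right_diff_distrib)
qed (simp add: lie_bracket_def)

lemma lie_bracket_vector_field:
  assumes X: "X \<in> vector_fields T A" and Y: "Y \<in> vector_fields T A"
  shows "lie_bracket T A X Y \<in> vector_fields T A"
  unfolding vector_fields_def mem_Collect_eq
proof (intro conjI allI ballI impI)
  show "lie_bracket T A X Y p \<in> tangent_space T A p" if "p \<in> topspace T" for p
    by (rule lie_bracket_tangent[OF X Y that])
  show "lie_bracket T A X Y p = 0" if "p \<notin> topspace T" for p
    using that smooth_near_topspace by (auto simp: lie_bracket_def fun_eq_iff)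
  fix W f assume W: "openin T W" and f: "smooth_fun_on A W f"
  have "smooth_fun_on A W (\<lambda>p. X p (\<lambda>q. Y q f) + (-1) * Y p (\<lambda>q. X q f))"
    by (rule smooth_fun_on_add[OF W _ smooth_fun_on_mult[OF W smooth_fun_on_const]])
      (fact vector_field_smooth[OF X W vector_field_smooth[OF Y W f]]
        vector_field_smooth[OF Y W vector_field_smooth[OF X W f]])+
  then show "smooth_fun_on A W (\<lambda>p. lie_bracket T A X Y p f)"
    by (rule smooth_fun_on_cong[OF W, rotated]) (simp add: lie_bracket_apply smooth_nearI[OF W _ f])
qed

lemma lie_bracket_linear:
  assumes X: "X \<in> vector_fields T A" and Y: "Y \<in> vector_fields T A" and Z: "Z \<in> vector_fields T A"
  shows "lie_bracket T A X (c *\<^sub>R Y + d *\<^sub>R Z) = c *\<^sub>R lie_bracket T A X Y + d *\<^sub>R lie_bracket T A X Z"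
proof (intro ext)
  fix p f
  show "lie_bracket T A X (c *\<^sub>R Y + d *\<^sub>R Z) p f = (c *\<^sub>R lie_bracket T A X Y + d *\<^sub>R lie_bracket T A X Z) p f"
  proof (cases "smooth_near T A p f")
    case True
    note near = vector_field_smooth_near[OF Y True] vector_field_smooth_near[OF Z True]
    have "X p \<in> tangent_space T A p"
      using vector_field_tangent[OF X smooth_near_topspace[OF True]] .
    from tangent_add[OF this smooth_near_cmult[OF near(1)] smooth_near_cmult[OF near(2)]]
      tangent_cmult[OF this near(1)] tangent_cmult[OF this near(2)]
    have "X p (\<lambda>q. c * Y q f + d * Z q f) = c * X p (\<lambda>q. Y q f) + d * X p (\<lambda>q. Z q f)"
      by simp
    then show ?thesis
      using True by (simp add: lie_bracket_apply scaleR_fun_def algebra_simps)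
  qed (simp add: lie_bracket_def scaleR_fun_def)
qed

end


section \<open>Left-invariant vector fields\<close>

context lie_group
begin

section \<open>Group multiplication in charts\<close>

lemma openin_mult_preimage:
  assumes "openin T W"
  shows "openin (prod_topology T T) {z \<in> topspace T \<times> topspace T. (case z of (x, y) \<Rightarrow> x \<otimes> y) \<in> W}"
  using openin_continuous_map_preimage[OF _ assms, of "prod_topology T T" "\<lambda>(x, y). x \<otimes> y"] smooth_mult
  unfolding smooth_map_def by simp

lemma mult_preimage_box:
  assumes "openin T W" "x \<in> carrier G" "y \<in> carrier G" "x \<otimes> y \<in> W"
  obtains M N where "openin T M" "openin T N" "x \<in> M" "y \<in> N" "\<And>x y. x \<in> M \<Longrightarrow> y \<in> N \<Longrightarrow> x \<otimes> y \<in> W"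
proof -
  have "\<exists>M N. openin T M \<and> openin T N \<and> x \<in> M \<and> y \<in> N \<and>
      M \<times> N \<subseteq> {z \<in> topspace T \<times> topspace T. (case z of (x, y) \<Rightarrow> x \<otimes> y) \<in> W}"
    using openin_mult_preimage[OF assms(1)] assms(2-) carrier_eq_topspace
    unfolding openin_prod_topology_alt by simp
  then show ?thesis
    using that by fast
qed

lemma openin_translation_preimage:
  assumes "openin T W" "a \<in> carrier G"
  shows "openin T {x \<in> carrier G. a \<otimes> x \<in> W}"
proof (subst openin_subopen, clarify)
  fix x assume x: "x \<in> carrier G" "a \<otimes> x \<in> W"
  obtain M N where N: "openin T N" "x \<in> N" "a \<in> M" "\<And>x y. x \<in> M \<Longrightarrow> y \<in> N \<Longrightarrow> x \<otimes> y \<in> W"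
    using mult_preimage_box[OF assms(1,2) x] by metis
  then have "N \<subseteq> {x \<in> carrier G. a \<otimes> x \<in> W}"
    using openin_subset[OF N(1)] carrier_eq_topspace by auto
  then show "\<exists>N. openin T N \<and> x \<in> N \<and> N \<subseteq> {x \<in> carrier G. a \<otimes> x \<in> W}"
    using N by blast
qed

text \<open>Has the shape of the domain in \<open>smooth_map\<close> for a chart of the product
  atlas, so for a chart domain W the assumption \<open>smooth_mult\<close> applies by unfolding. A
  general W is allowed because the functions to be composed with the product may live on several
  charts.\<close>

definition mult_domain :: "'a set \<Rightarrow> ('a \<Rightarrow> 'e) \<Rightarrow> 'a set \<Rightarrow> ('a \<Rightarrow> 'e) \<Rightarrow> 'a set \<Rightarrow> ('e \<times> 'e) set"
  where "mult_domain U \<phi> V \<psi> W = map_prod \<phi> \<psi> ` {z \<in> U \<times> V. (case z of (x, y) \<Rightarrow> x \<otimes> y) \<in> W}"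

lemma open_mult_domain:
  assumes U: "(U, \<phi>) \<in> A" and V: "(V, \<psi>) \<in> A" and W: "openin T W"
  shows "open (mult_domain U \<phi> V \<psi> W)"
proof (subst open_subopen, clarify)
  fix a b assume "(a, b) \<in> mult_domain U \<phi> V \<psi> W"
  then obtain x y where xy: "x \<in> U" "y \<in> V" "x \<otimes> y \<in> W" "a = \<phi> x" "b = \<psi> y"
    by (auto simp: mult_domain_def)
  have xG: "x \<in> carrier G" and yG: "y \<in> carrier G"
    using xy chart_subset[OF U] chart_subset[OF V] carrier_eq_topspace by auto
  obtain M N where MN: "openin T M" "openin T N" "x \<in> M" "y \<in> N" "\<And>x y. x \<in> M \<Longrightarrow> y \<in> N \<Longrightarrow> x \<otimes> y \<in> W"
    using mult_preimage_box[OF W xG yG xy(3)] by metis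
  have "(\<phi> u, \<psi> v) \<in> mult_domain U \<phi> V \<psi> W" if "u \<in> U \<inter> M" "v \<in> V \<inter> N" for u v
    unfolding mult_domain_def by (rule image_eqI[of _ _ "(u, v)"]) (use that MN(5) in auto)
  then have "\<phi> ` (U \<inter> M) \<times> \<psi> ` (V \<inter> N) \<subseteq> mult_domain U \<phi> V \<psi> W"
    by auto
  moreover have "open (\<phi> ` (U \<inter> M) \<times> \<psi> ` (V \<inter> N))"
    by (intro open_Times open_chart_image U V MN)
  moreover have "(a, b) \<in> \<phi> ` (U \<inter> M) \<times> \<psi> ` (V \<inter> N)"
    using xy MN by blast
  ultimately show "\<exists>S. open S \<and> (a, b) \<in> S \<and> S \<subseteq> mult_domain U \<phi> V \<psi> W"
    by blast
qed

text \<open>Near a given pair, a chart at the product factors the map as f in that chart after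
  multiplication in charts. Joint smoothness is used twice: with the first variable frozen for
  translations, and differentiated in the second variable for left-invariant fields.\<close>

lemma smooth_on_mult_domain:
  assumes U: "(U, \<phi>) \<in> A" and V: "(V, \<psi>) \<in> A" and W: "openin T W" and f: "smooth_fun_on A W f"
  shows "smooth_on (mult_domain U \<phi> V \<psi> W) (\<lambda>z. f (inv_into U \<phi> (fst z) \<otimes> inv_into V \<psi> (snd z)))"
    (is "smooth_on _ ?F")
proof (rule smooth_on_local[OF open_mult_domain[OF U V W]])
  fix z assume "z \<in> mult_domain U \<phi> V \<psi> W"
  then obtain x y where xy: "x \<in> U" "y \<in> V" "x \<otimes> y \<in> W" "z = (\<phi> x, \<psi> y)"
    by (auto simp: mult_domain_def)
  obtain C \<eta> where C: "(C, \<eta>) \<in> A" "x \<otimes> y \<in> C"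
    using chart_at xy(3) openin_subset[OF W] by blast
  let ?N = "mult_domain U \<phi> V \<psi> (C \<inter> W)"
  let ?m = "\<eta> \<circ> (\<lambda>(x, y). x \<otimes> y) \<circ> inv_into (U \<times> V) (map_prod \<phi> \<psi>)"
  have N: "open ?N" "z \<in> ?N"
    using open_mult_domain[OF U V openin_Int[OF chart_open[OF C(1)] W]] xy C(2)
    by (auto simp: mult_domain_def)
  have inv: "inv_into (U \<times> V) (map_prod \<phi> \<psi>) (\<phi> x, \<psi> y) = (x, y)" if "x \<in> U" "y \<in> V" for x y
    using inv_into_f_f[OF map_prod_inj_on[OF chart_inj[OF U] chart_inj[OF V]], of "(x, y)"] that by simp
  have "(U \<times> V, map_prod \<phi> \<psi>) \<in> prod_atlas A A"
    unfolding prod_atlas_def using U V by blast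
  then have "smooth_on (mult_domain U \<phi> V \<psi> C) ?m"
    using smooth_mult C(1) unfolding smooth_map_def mult_domain_def by fast
  then have "smooth_on ?N ?m"
    by (rule smooth_on_subset) (auto simp: mult_domain_def)
  moreover have "?m ` ?N \<subseteq> \<eta> ` (C \<inter> W)"
    by (auto simp: mult_domain_def inv)
  ultimately have "smooth_on ?N (\<lambda>z. (f \<circ> inv_into C \<eta>) (?m z))"
    using smooth_on_compose[OF N(1)] smooth_fun_onD[OF f C(1)] by blast
  then have "smooth_on ?N ?F"
    by (rule smooth_on_cong[OF N(1), rotated])
      (auto simp: mult_domain_def inv inv_chart[OF U] inv_chart[OF V] inv_chart[OF C(1)])
  then show "\<exists>N. open N \<and> z \<in> N \<and> smooth_on N ?F"
    using N by blast
qed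

lemma smooth_fun_on_translate:
  assumes W: "openin T W" and f: "smooth_fun_on A W f" and a: "a \<in> carrier G"
  shows "smooth_fun_on A {x \<in> carrier G. a \<otimes> x \<in> W} (\<lambda>x. f (a \<otimes> x))"
proof (rule smooth_fun_onI_local[OF openin_translation_preimage[OF W a]])
  let ?W = "{x \<in> carrier G. a \<otimes> x \<in> W}"
  fix p assume p: "p \<in> ?W"
  obtain U \<phi> where U: "(U, \<phi>) \<in> A" "a \<in> U"
    using chart_at a carrier_eq_topspace by blast
  obtain V \<psi> where V: "(V, \<psi>) \<in> A" "p \<in> V"
    using chart_at p carrier_eq_topspace by blast
  have op: "open (\<psi> ` (V \<inter> ?W))"
    by (rule open_chart_image[OF V(1) openin_translation_preimage[OF W a]])
  have "smooth_on (\<psi> ` (V \<inter> ?W)) (\<lambda>y. (\<phi> a, y))"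
    by (intro smooth_on_Pair op smooth_on_const smooth_on_bounded_linear bounded_linear_ident)
  moreover have "(\<lambda>y. (\<phi> a, y)) ` (\<psi> ` (V \<inter> ?W)) \<subseteq> mult_domain U \<phi> V \<psi> W"
    using U(2) by (force simp: mult_domain_def)
  ultimately have "smooth_on (\<psi> ` (V \<inter> ?W))
      (\<lambda>y. f (inv_into U \<phi> (fst (\<phi> a, y)) \<otimes> inv_into V \<psi> (snd (\<phi> a, y))))"
    using smooth_on_compose[OF op _ _ smooth_on_mult_domain[OF U(1) V(1) W f]] by blast
  then have "smooth_on (\<psi> ` (V \<inter> ?W)) ((\<lambda>x. f (a \<otimes> x)) \<circ> inv_into V \<psi>)"
    by (simp add: o_def inv_chart[OF U])
  then show "\<exists>U \<phi> N. (U, \<phi>) \<in> A \<and> p \<in> U \<and> openin T N \<and> p \<in> N \<and>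
      smooth_on (\<phi> ` (U \<inter> N)) ((\<lambda>x. f (a \<otimes> x)) \<circ> inv_into U \<phi>)"
    using V p openin_translation_preimage[OF W a] by blast
qed

lemma smooth_near_translate:
  assumes "smooth_near T A (a \<otimes> b) f" "a \<in> carrier G" "b \<in> carrier G"
  shows "smooth_near T A b (\<lambda>x. f (a \<otimes> x))"
proof -
  obtain W where W: "openin T W" "a \<otimes> b \<in> W" "smooth_fun_on A W f"
    using assms(1) unfolding smooth_near_def by blast
  then show ?thesis
    using assms smooth_nearI[OF openin_translation_preimage[OF W(1) assms(2)] _
        smooth_fun_on_translate[OF W(1,3) assms(2)]] by blast
qed

section \<open>Differentials of left translations\<close>

abbreviation push :: "'a \<Rightarrow> 'a \<Rightarrow> 'a tangent_vector \<Rightarrow> 'a tangent_vector"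
  where "push a \<equiv> pushforward T A (\<lambda>x. a \<otimes> x)"

lemma push_apply: "smooth_near T A (a \<otimes> b) f \<Longrightarrow> push a b v f = v (\<lambda>x. f (a \<otimes> x))"
  by (simp add: pushforward_def o_def)

lemma push_linear: "push a b (c *\<^sub>R u + d *\<^sub>R v) = c *\<^sub>R push a b u + d *\<^sub>R push a b v"
  by (auto simp: pushforward_def scaleR_fun_def)

lemma push_zero: "push a b 0 = 0"
  by (auto simp: pushforward_def)

lemma push_tangent:
  assumes v: "v \<in> tangent_space T A b" and "a \<in> carrier G" "b \<in> carrier G"
  shows "push a b v \<in> tangent_space T A (a \<otimes> b)"
  by (rule tangent_spaceI)
    (simp_all add: push_apply smooth_near_add smooth_near_mult smooth_near_cmult pushforward_def o_def
      smooth_near_translate assms tangent_add[OF v] tangent_mult[OF v] tangent_cmult[OF v])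

lemma push_push:
  assumes v: "v \<in> tangent_space T A c" and a: "a \<in> carrier G" and b: "b \<in> carrier G" and c: "c \<in> carrier G"
  shows "push a (b \<otimes> c) (push b c v) = push (a \<otimes> b) c v"
proof
  fix f
  show "push a (b \<otimes> c) (push b c v) f = push (a \<otimes> b) c v f"
  proof (cases "smooth_near T A (a \<otimes> (b \<otimes> c)) f")
    case True
    have f: "smooth_near T A (b \<otimes> c) (\<lambda>x. f (a \<otimes> x))"
      using smooth_near_translate True a b c by simp
    have "push a (b \<otimes> c) (push b c v) f = v (\<lambda>x. f (a \<otimes> (b \<otimes> x)))"
      by (simp add: push_apply True f)
    \<comment> \<open>Associativity holds on the carrier only, so the two functions may differ off
      it; locality on \<open>topspace T\<close> identifies their derivatives.\<close>
    also have "\<dots> = v (\<lambda>x. f (a \<otimes> b \<otimes> x))"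
      by (rule tangent_local[OF v openin_topspace])
        (use a b c m_assoc carrier_eq_topspace smooth_near_translate[OF f b c] in auto)
    also have "\<dots> = push (a \<otimes> b) c v f"
      using True a b c by (simp add: push_apply m_assoc)
    finally show ?thesis .
  next
    case False
    then show ?thesis
      using a b c by (simp add: pushforward_def m_assoc)
  qed
qed

lemma push_one:
  assumes v: "v \<in> tangent_space T A b" and b: "b \<in> carrier G"
  shows "push \<one> b v = v"
proof
  fix f
  show "push \<one> b v f = v f"
  proof (cases "smooth_near T A b f")
    case True
    then have "push \<one> b v f = v (\<lambda>x. f (\<one> \<otimes> x))"
      using b by (simp add: push_apply)
    also have "\<dots> = v f"
      by (rule tangent_local[OF v openin_topspace, symmetric]) (use b True carrier_eq_topspace in auto)
    finally show ?thesis .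
  next
    case False
    then show ?thesis
      using b tangent_not_smooth[OF v] by (simp add: pushforward_def)
  qed
qed

section \<open>The Lie algebra and its bracket\<close>

abbreviation \<g> :: "'a vector_field set"
  where "\<g> \<equiv> lie_algebra G T A"

lemma lie_algebra_vector_field: "X \<in> \<g> \<Longrightarrow> X \<in> vector_fields T A"
  unfolding lie_algebra_def by blast

lemma lie_algebra_push: "X \<in> \<g> \<Longrightarrow> a \<in> carrier G \<Longrightarrow> b \<in> carrier G \<Longrightarrow> push a b (X b) = X (a \<otimes> b)"
  unfolding lie_algebra_def by blast

lemma lie_algebra_tangent: "X \<in> \<g> \<Longrightarrow> p \<in> carrier G \<Longrightarrow> X p \<in> tangent_space T A p"
  using vector_field_tangent lie_algebra_vector_field carrier_eq_topspace by blast

lemma lie_algebra_value: "X \<in> \<g> \<Longrightarrow> a \<in> carrier G \<Longrightarrow> X a = push a \<one> (X \<one>)"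
  using lie_algebra_push[of X a \<one>] by simp

lemma lie_algebra_eqI:
  assumes "X \<in> \<g>" "Y \<in> \<g>" "X \<one> = Y \<one>"
  shows "X = Y"
proof
  fix a
  show "X a = Y a"
    using assms lie_algebra_value[of _ a] vector_field_outside[OF lie_algebra_vector_field, of _ a]
      carrier_eq_topspace by (cases "a \<in> carrier G") auto
qed

lemma lie_algebra_subspace: "subspace \<g>"
proof (rule subspaceI)
  show "0 \<in> \<g>"
    unfolding lie_algebra_def using subspace_0[OF vector_fields_subspace] by (simp add: push_zero)
next
  fix X Y assume "X \<in> \<g>" "Y \<in> \<g>"
  then show "X + Y \<in> \<g>"
    unfolding lie_algebra_def using subspace_add[OF vector_fields_subspace]
      push_linear[of _ _ 1 _ 1] by simp
next
  fix X c assume "X \<in> \<g>"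
  moreover have "(c *\<^sub>R X) p = c *\<^sub>R X p" for p
    by (simp add: scaleR_fun_def)
  ultimately show "c *\<^sub>R X \<in> \<g>"
    unfolding lie_algebra_def using subspace_mul[OF vector_fields_subspace]
      push_linear[of _ _ c _ 0] by simp
qed

lemma lie_bracket_lie_algebra:
  assumes X: "X \<in> \<g>" and Y: "Y \<in> \<g>"
  shows "lie_bracket T A X Y \<in> \<g>"
proof -
  note XV = lie_algebra_vector_field[OF X] and YV = lie_algebra_vector_field[OF Y]
  \<comment> \<open>Left invariance is used twice: for Y at all points q with f smooth near the
    product of a and q, then for X at b. Each half of the bracket is an instance.\<close>
  have aux: "X b (\<lambda>q. Y q (\<lambda>x. f (a \<otimes> x))) = X (a \<otimes> b) (\<lambda>q. Y q f)"
    if X: "X \<in> \<g>" and Y: "Y \<in> \<g>" and a: "a \<in> carrier G" and b: "b \<in> carrier G"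
      and f: "smooth_near T A (a \<otimes> b) f" for X Y a b f
  proof -
    note YV = lie_algebra_vector_field[OF Y]
    obtain W where W: "openin T W" "a \<otimes> b \<in> W" "smooth_fun_on A W f"
      using f unfolding smooth_near_def by blast
    have "X b (\<lambda>q. Y q (\<lambda>x. f (a \<otimes> x))) = X b (\<lambda>q. Y (a \<otimes> q) f)"
    proof (rule tangent_local[OF lie_algebra_tangent[OF X b] openin_translation_preimage[OF W(1) a]])
      show "b \<in> {x \<in> carrier G. a \<otimes> x \<in> W}"
        using b W by simp
      show "smooth_near T A b (\<lambda>q. Y q (\<lambda>x. f (a \<otimes> x)))"
        by (intro vector_field_smooth_near[OF YV] smooth_near_translate f a b)
      fix q assume q: "q \<in> {x \<in> carrier G. a \<otimes> x \<in> W}"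
      then have "smooth_near T A (a \<otimes> q) f"
        using W smooth_nearI by blast
      then show "Y q (\<lambda>x. f (a \<otimes> x)) = Y (a \<otimes> q) f"
        using push_apply[of a q f "Y q"] lie_algebra_push[OF Y a, of q] q by simp
    qed
    also have "\<dots> = push a b (X b) (\<lambda>q. Y q f)"
      by (rule push_apply[symmetric]) (rule vector_field_smooth_near[OF YV f])
    finally show ?thesis
      using lie_algebra_push[OF X a b] by simp
  qed
  have "push a b (lie_bracket T A X Y b) f = lie_bracket T A X Y (a \<otimes> b) f"
    if a: "a \<in> carrier G" and b: "b \<in> carrier G" for a b f
  proof (cases "smooth_near T A (a \<otimes> b) f")
    case True
    then show ?thesis
      using aux[OF X Y a b True] aux[OF Y X a b True]
      by (simp add: push_apply lie_bracket_apply smooth_near_translate[OF True a b])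
  qed (simp add: pushforward_def lie_bracket_def)
  then show ?thesis
    unfolding lie_algebra_def using lie_bracket_vector_field[OF XV YV] by blast
qed

section \<open>Left-invariant extension of a tangent vector at the identity\<close>

definition left_invariant_field :: "'a tangent_vector \<Rightarrow> 'a vector_field"
  where "left_invariant_field v = (\<lambda>a. if a \<in> carrier G then push a \<one> v else 0)"

lemma left_invariant_field_one: "v \<in> tangent_space T A \<one> \<Longrightarrow> left_invariant_field v \<one> = v"
  by (simp add: left_invariant_field_def push_one)

text \<open>
  In charts, \<open>a \<mapsto> v (f \<circ> L\<^sub>a)\<close> is a combination of partial derivatives of \<open>(x, y) \<mapsto> f (x y)\<close> in the
  second variable, at \<open>y = \<one>\<close>.
\<close>

lemma smooth_fun_on_left_invariant_field:
  assumes v: "v \<in> tangent_space T A \<one>" and W: "openin T W" and f: "smooth_fun_on A W f"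
  shows "smooth_fun_on A W (\<lambda>a. left_invariant_field v a f)"
proof (rule smooth_fun_onI_local[OF W])
  fix p assume p: "p \<in> W"
  obtain U \<phi> where U: "(U, \<phi>) \<in> A" "p \<in> U"
    using chart_at p openin_subset[OF W] by blast
  obtain V \<psi> where V: "(V, \<psi>) \<in> A" "\<one> \<in> V"
    using chart_at one_closed carrier_eq_topspace by blast
  let ?F = "\<lambda>z. f (inv_into U \<phi> (fst z) \<otimes> inv_into V \<psi> (snd z))"
  let ?D = "\<lambda>z. frechet_derivative ?F (at z)"
  have F: "smooth_on (mult_domain U \<phi> V \<psi> W) ?F"
    by (rule smooth_on_mult_domain[OF U(1) V(1) W f])
  have op: "open (\<phi> ` (U \<inter> W))"
    by (rule open_chart_image[OF U(1) W])
  have WG: "W \<subseteq> carrier G"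
    using openin_subset[OF W] carrier_eq_topspace by simp
  have dom: "(\<phi> a, \<psi> \<one>) \<in> mult_domain U \<phi> V \<psi> W" if "a \<in> U \<inter> W" for a
    unfolding mult_domain_def by (rule image_eqI[of _ _ "(a, \<one>)"]) (use that V(2) WG in auto)
  \<comment> \<open>The coefficients \<open>v (\<lambda>x. \<psi> x \<bullet> b)\<close> do not
    depend on a, so only the partial derivatives of \<open>?F\<close> vary with a.\<close>
  have field_eq: "left_invariant_field v a f =
      (\<Sum>b\<in>Basis. v (\<lambda>x. \<psi> x \<bullet> b) * ?D (\<phi> a, \<psi> \<one>) (0, b))" if a: "a \<in> U \<inter> W" for a
  proof -
    have aG: "a \<in> carrier G"
      using a WG by blast
    have near: "smooth_near T A (a \<otimes> \<one>) f"
      using a aG smooth_nearI[OF W _ f] by simp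
    have partial: "frechet_derivative ((\<lambda>x. f (a \<otimes> x)) \<circ> inv_into V \<psi>) (at (\<psi> \<one>)) b =
        ?D (\<phi> a, \<psi> \<one>) (0, b)" for b
    proof -
      have "(?F has_derivative ?D (\<phi> a, \<psi> \<one>)) (at (\<phi> a, \<psi> \<one>))"
        using smooth_on_differentiable[OF F dom[OF a]] frechet_derivative_works by blast
      moreover have "((\<lambda>y. (\<phi> a, y)) has_derivative (\<lambda>b. (0, b))) (at (\<psi> \<one>))"
        by (intro has_derivative_Pair has_derivative_const has_derivative_ident)
      ultimately have deriv: "(?F \<circ> (\<lambda>y. (\<phi> a, y)) has_derivative ?D (\<phi> a, \<psi> \<one>) \<circ> (\<lambda>b. (0, b))) (at (\<psi> \<one>))"
        using diff_chain_at by blast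
      \<comment> \<open>An equality of functions on the whole Euclidean space, so the Frechet
        derivatives can be compared by rewriting.\<close>
      have eq: "?F \<circ> (\<lambda>y. (\<phi> a, y)) = (\<lambda>x. f (a \<otimes> x)) \<circ> inv_into V \<psi>"
        using a by (auto simp: o_def inv_chart[OF U(1)])
      show ?thesis
        using fun_cong[OF frechet_derivative_at[OF deriv[unfolded eq]], of b] by simp
    qed
    have "left_invariant_field v a f = v (\<lambda>x. f (a \<otimes> x))"
      using aG near by (simp add: left_invariant_field_def push_apply)
    also have "\<dots> = (\<Sum>b\<in>Basis. v (\<lambda>x. \<psi> x \<bullet> b) *
        frechet_derivative ((\<lambda>x. f (a \<otimes> x)) \<circ> inv_into V \<psi>) (at (\<psi> \<one>)) b)"
      by (rule tangent_coordinates[OF V v smooth_near_translate[OF near aG one_closed]])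
    finally show ?thesis
      unfolding partial .
  qed
  have "smooth_on (\<phi> ` (U \<inter> W)) (\<lambda>x. \<Sum>b\<in>Basis. v (\<lambda>x. \<psi> x \<bullet> b) * ?D (x, \<psi> \<one>) (0, b))"
  proof (intro smooth_on_sum smooth_on_mult smooth_on_const op)
    fix b
    show "smooth_on (\<phi> ` (U \<inter> W)) (\<lambda>x. ?D (x, \<psi> \<one>) (0, b))"
    proof (rule smooth_on_compose[OF op _ _ smooth_on_frechet_derivative[OF F]])
      show "(\<lambda>x. (x, \<psi> \<one>)) ` (\<phi> ` (U \<inter> W)) \<subseteq> mult_domain U \<phi> V \<psi> W"
        using dom by auto
      show "smooth_on (\<phi> ` (U \<inter> W)) (\<lambda>x. (x, \<psi> \<one>))"
        by (intro smooth_on_Pair op smooth_on_const smooth_on_bounded_linear bounded_linear_ident)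
    qed
  qed
  then have "smooth_on (\<phi> ` (U \<inter> W)) ((\<lambda>a. left_invariant_field v a f) \<circ> inv_into U \<phi>)"
    by (rule smooth_on_cong[OF op, rotated]) (auto simp: inv_chart[OF U(1)] field_eq)
  then show "\<exists>U \<phi> N. (U, \<phi>) \<in> A \<and> p \<in> U \<and> openin T N \<and> p \<in> N \<and>
      smooth_on (\<phi> ` (U \<inter> N)) ((\<lambda>a. left_invariant_field v a f) \<circ> inv_into U \<phi>)"
    using U W p by blast
qed

lemma left_invariant_field_lie_algebra:
  assumes v: "v \<in> tangent_space T A \<one>"
  shows "left_invariant_field v \<in> \<g>"
proof -
  have "left_invariant_field v \<in> vector_fields T A"
    unfolding vector_fields_def mem_Collect_eq
  proof (intro conjI allI ballI impI)
    show "left_invariant_field v p \<in> tangent_space T A p" if "p \<in> topspace T" for p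
      using push_tangent[OF v _ one_closed, of p] that
      by (simp add: left_invariant_field_def carrier_eq_topspace[symmetric])
    show "left_invariant_field v p = 0" if "p \<notin> topspace T" for p
      using that carrier_eq_topspace by (simp add: left_invariant_field_def)
  qed (rule smooth_fun_on_left_invariant_field[OF v])
  moreover have "push a b (left_invariant_field v b) = left_invariant_field v (a \<otimes> b)"
    if "a \<in> carrier G" "b \<in> carrier G" for a b
    using push_push[OF v that one_closed] that by (simp add: left_invariant_field_def)
  ultimately show ?thesis
    unfolding lie_algebra_def by blast
qed

text \<open>Evaluation at the identity keeps B independent and places it in a finitely spanned
  space. Finiteness gives the trace its meaning: over an infinite B the sum in
  \<open>trace_on\<close> would be 0 by convention.\<close>

lemma lie_algebra_independent_finite:
  assumes B: "B \<subseteq> \<g>" "independent B"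
  shows "finite B"
proof -
  let ?ev = "\<lambda>Y :: 'a vector_field. Y \<one>"
  obtain D where D: "finite D" "tangent_space T A \<one> \<subseteq> span D"
    using tangent_space_finite_dim one_closed carrier_eq_topspace by blast
  have lin: "linear ?ev"
    by (rule linearI) (simp_all add: scaleR_fun_def)
  have "span B \<subseteq> \<g>"
    by (rule span_minimal[OF B(1) lie_algebra_subspace])
  then have inj: "inj_on ?ev (span B)"
    using lie_algebra_eqI by (auto intro!: inj_onI)
  have "independent (?ev ` B)"
    by (rule linear_independent_injective_image[OF lin B(2) inj])
  moreover have "?ev ` B \<subseteq> span D"
    using B(1) D(2) lie_algebra_tangent[OF _ one_closed] by blast
  ultimately have "finite (?ev ` B)"
    using independent_span_bound[OF D(1)] by blast
  then show ?thesis
    by (rule finite_imageD) (rule inj_on_subset[OF inj span_superset])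
qed

text \<open>Serves the case of an empty basis. Translating v to the identity and extending it gives
  a left-invariant field, hence 0; translating back recovers v.\<close>

lemma lie_algebra_trivial_tangent:
  assumes "\<g> \<subseteq> {0}" and p: "p \<in> carrier G" and v: "v \<in> tangent_space T A p"
  shows "v = 0"
proof -
  let ?w = "push (inv p) p v"
  have w: "?w \<in> tangent_space T A \<one>"
    using push_tangent[OF v inv_closed[OF p] p] p by simp
  have "left_invariant_field ?w = 0"
    using left_invariant_field_lie_algebra[OF w] assms(1) by blast
  then have "?w = 0"
    using left_invariant_field_one[OF w] by simp
  then show ?thesis
    using push_push[OF v p inv_closed[OF p] p] push_one[OF v p] p push_zero by simp
qed

section \<open>The invariant metric on the Lie algebra and the trace argument\<close>

lemma left_invariant_metric_constant:
  assumes "left_invariant_metric G T A g" "Y \<in> \<g>" "Z \<in> \<g>" "p \<in> carrier G"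
  shows "g p (Y p) (Z p) = g \<one> (Y \<one>) (Z \<one>)"
proof -
  have "g (p \<otimes> \<one>) (push p \<one> (Y \<one>)) (push p \<one> (Z \<one>)) = g \<one> (Y \<one>) (Z \<one>)"
    using assms(1,4) one_closed lie_algebra_tangent[OF assms(2) one_closed]
      lie_algebra_tangent[OF assms(3) one_closed] unfolding left_invariant_metric_def by blast
  then show ?thesis
    using lie_algebra_value[OF assms(2,4)] lie_algebra_value[OF assms(3,4)] assms(4) by simp
qed

lemma nondegenerate_form_lie_algebra:
  assumes g: "pseudo_riemannian_metric T A g"
  shows "nondegenerate_form \<g> (\<lambda>Y Z. g \<one> (Y \<one>) (Z \<one>))"
proof
  have one: "\<one> \<in> topspace T"
    using one_closed carrier_eq_topspace by simp
  note tan = lie_algebra_tangent[OF _ one_closed]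
  show "subspace \<g>"
    by (rule lie_algebra_subspace)
  show "g \<one> (Y \<one>) (Z \<one>) = g \<one> (Z \<one>) (Y \<one>)" if "Y \<in> \<g>" "Z \<in> \<g>" for Y Z
    using g one tan[OF that(1)] tan[OF that(2)] unfolding pseudo_riemannian_metric_def by blast
  show "g \<one> ((c *\<^sub>R X + d *\<^sub>R Y) \<one>) (Z \<one>) = c * g \<one> (X \<one>) (Z \<one>) + d * g \<one> (Y \<one>) (Z \<one>)"
    if "X \<in> \<g>" "Y \<in> \<g>" "Z \<in> \<g>" for X Y Z c d
  proof -
    have "(c *\<^sub>R X + d *\<^sub>R Y) \<one> = c *\<^sub>R X \<one> + d *\<^sub>R Y \<one>"
      by (simp add: scaleR_fun_def)
    then show ?thesis
      using g one tan[OF that(1)] tan[OF that(2)] tan[OF that(3)]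
      unfolding pseudo_riemannian_metric_def by simp
  qed
  fix Y assume Y: "Y \<in> \<g>" and 0: "\<And>Z. Z \<in> \<g> \<Longrightarrow> g \<one> (Y \<one>) (Z \<one>) = 0"
  \<comment> \<open>Every tangent vector at the identity is the value of a left-invariant field, so
    orthogonality to the Lie algebra is orthogonality to the whole tangent space.\<close>
  have "g \<one> (Y \<one>) v = 0" if "v \<in> tangent_space T A \<one>" for v
    using 0[OF left_invariant_field_lie_algebra[OF that]] left_invariant_field_one[OF that] by simp
  then have "Y \<one> = 0"
    using g one tan[OF Y] unfolding pseudo_riemannian_metric_def by blast
  then show "Y = 0"
    using lie_algebra_eqI[OF Y subspace_0[OF lie_algebra_subspace]] by simp
qed

lemma lie_derivative_metric_left_invariant:
  assumes g: "left_invariant_metric G T A g" and X: "X \<in> \<g>" and Y: "Y \<in> \<g>" and Z: "Z \<in> \<g>"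
    and p: "p \<in> carrier G"
  shows "lie_derivative_metric T A g X Y Z p =
    - g \<one> (lie_bracket T A X Y \<one>) (Z \<one>) - g \<one> (Y \<one>) (lie_bracket T A X Z \<one>)"
proof -
  have pT: "p \<in> topspace T"
    using p carrier_eq_topspace by simp
  have Xp: "X p \<in> tangent_space T A p"
    by (rule lie_algebra_tangent[OF X p])
  have "X p (\<lambda>_. g \<one> (Y \<one>) (Z \<one>)) = X p (\<lambda>q. g q (Y q) (Z q))"
    by (rule tangent_local[OF Xp openin_topspace pT _ smooth_near_const[OF pT]])
      (use left_invariant_metric_constant[OF g Y Z] carrier_eq_topspace in simp)
  then have "X p (\<lambda>q. g q (Y q) (Z q)) = 0"
    using tangent_const[OF Xp pT] by simp
  then show ?thesis
    unfolding lie_derivative_metric_def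
    using left_invariant_metric_constant[OF g lie_bracket_lie_algebra[OF X Y] Z p]
      left_invariant_metric_constant[OF g Y lie_bracket_lie_algebra[OF X Z] p] by simp
qed

lemma conformal_lie_algebra_killing:
  assumes unimodular: "unimodular G T A"
    and metric: "pseudo_riemannian_metric T A g"
    and invariant: "left_invariant_metric G T A g"
    and X: "X \<in> \<g>"
    and conformal: "conformal_vector_field T A g X"
  shows "killing_vector_field T A g X"
proof -
  interpret nondegenerate_form \<g> "\<lambda>Y Z. g \<one> (Y \<one>) (Z \<one>)"
    by (rule nondegenerate_form_lie_algebra[OF metric])
  note XV = lie_algebra_vector_field[OF X]
  obtain \<rho> where \<rho>: "\<And>Y Z p. Y \<in> vector_fields T A \<Longrightarrow> Z \<in> vector_fields T A \<Longrightarrow> p \<in> topspace T \<Longrightarrow>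
      lie_derivative_metric T A g X Y Z p = 2 * \<rho> p * g p (Y p) (Z p)"
    using conformal unfolding conformal_vector_field_def by blast
  \<comment> \<open>The very basis selected inside \<open>trace_on\<close>, so that unimodularity
    becomes a statement about B by folding.\<close>
  define B where "B = (SOME B. B \<subseteq> \<g> \<and> independent B \<and> \<g> \<subseteq> span B)"
  have "B \<subseteq> \<g> \<and> independent B \<and> \<g> \<subseteq> span B"
    unfolding B_def by (rule someI_ex) (metis maximal_independent_subset)
  then have B: "B \<subseteq> \<g>" "independent B" "\<g> \<subseteq> span B"
    by auto
  have fin: "finite B"
    by (rule lie_algebra_independent_finite[OF B(1,2)])
  have trace: "(\<Sum>b\<in>B. representation B (lie_bracket T A X b) b) = 0"
    using unimodular X unfolding unimodular_def trace_on_def B_def[symmetric] by simp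
  \<comment> \<open>The point p is fixed and \<rho> p is treated as a number. Y and Z range over all
    smooth fields, as the Killing equation requires.\<close>
  have zero: "2 * \<rho> p * g p (Y p) (Z p) = 0"
    if Y: "Y \<in> vector_fields T A" and Z: "Z \<in> vector_fields T A" and p: "p \<in> topspace T" for Y Z p
  proof (cases "B = {}")
    case True
    then have "\<g> \<subseteq> {0}"
      using B(3) by simp
    then have "Y p = 0"
      using lie_algebra_trivial_tangent p vector_field_tangent[OF Y p] carrier_eq_topspace by blast
    \<comment> \<open>Linearity with zero coefficients shows that the metric vanishes when its first
      argument is 0.\<close>
    moreover have "g p (0 *\<^sub>R Y p + 0 *\<^sub>R Y p) (Z p) = 0 * g p (Y p) (Z p) + 0 * g p (Y p) (Z p)"
      using metric p vector_field_tangent[OF Y p] vector_field_tangent[OF Z p]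
      unfolding pseudo_riemannian_metric_def by blast
    ultimately show ?thesis by simp
  next
    case False
    \<comment> \<open>The brackets enter the Lie derivative with a minus sign, so ad_X has
      similarity factor -2 * \<rho> p. As B is finite and nonempty, the vanishing trace forces
      \<rho> p = 0.\<close>
    have "2 * (\<Sum>b\<in>B. representation B (lie_bracket T A X b) b) = - 2 * \<rho> p * card B"
    proof (rule trace_similarity[OF _ _ _ B fin])
      show "lie_bracket T A X Y \<in> \<g>" if "Y \<in> \<g>" for Y
        by (rule lie_bracket_lie_algebra[OF X that])
      show "lie_bracket T A X (c *\<^sub>R Y + d *\<^sub>R Z) = c *\<^sub>R lie_bracket T A X Y + d *\<^sub>R lie_bracket T A X Z"
        if "Y \<in> \<g>" "Z \<in> \<g>" for Y Z c d
        by (rule lie_bracket_linear[OF XV]) (use that lie_algebra_vector_field in blast)+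
      show "g \<one> (lie_bracket T A X Y \<one>) (Z \<one>) + g \<one> (Y \<one>) (lie_bracket T A X Z \<one>) =
          - 2 * \<rho> p * g \<one> (Y \<one>) (Z \<one>)" if Y: "Y \<in> \<g>" and Z: "Z \<in> \<g>" for Y Z
      proof -
        have pG: "p \<in> carrier G"
          using p carrier_eq_topspace by simp
        show ?thesis
          using \<rho>[OF lie_algebra_vector_field[OF Y] lie_algebra_vector_field[OF Z] p]
            lie_derivative_metric_left_invariant[OF invariant X Y Z pG]
            left_invariant_metric_constant[OF invariant Y Z pG] by simp
      qed
    qed
    then have "\<rho> p = 0"
      using trace False fin by simp
    then show ?thesis by simp
  qed
  show ?thesis
    unfolding killing_vector_field_def using XV \<rho> zero by simp
qed

end

theorem theorem1p1:
  fixes G :: "('a, 'm) monoid_scheme"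
    and T :: "'a topology"
    and A :: "('a, 'e::euclidean_space) atlas"
    and g :: "'a metric_tensor"
    and X :: "'a vector_field"
  assumes "lie_group G T A"
    and "unimodular G T A"
    and "pseudo_riemannian_metric T A g"
    and "left_invariant_metric G T A g"
    and "X \<in> lie_algebra G T A"
    and "conformal_vector_field T A g X"
  shows "killing_vector_field T A g X"
  using lie_group.conformal_lie_algebra_killing[OF assms] .

end
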